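(* There exist an absolute constant $C>0$ and a function $f:\mathbb{Z}_{\ge 1}\to\mathbb{R}$ with $f(N)\to 0$ as $N\to\infty$ such that for every integer $N\ge 1$, \[ r_3(N) \ge C\, N\, 2^{-(c+f(N))\,2\sqrt{2\log_2(N)}},\qquad\text{where } c:=\sqrt{\log_2\left(\sqrt{\tfrac{32}{9}}\right)}\approx 0.9567 .\]
   Context: A set $S$ of integers is 3-AP-free if the only solutions to $2y=x+z$ with $x,y,z\in S$ are those with $x=y=z$. For an integer $N\ge1$, $r_3(N)$ denotes the maximum cardinality of a 3-AP-free subset of $\{1,\dots,N\}$. *)

theory Defs
  imports Complex_Main
begin

definition three_AP_free :: "int set \<Rightarrow> bool" where
  "three_AP_free S \<longleftrightarrow>
     (\<forall>x\<in>S. \<forall>y\<in>S. \<forall>z\<in>S. 2 * y = x + z \<longrightarrow> x = y \<and> y = z)"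

definition r3 :: "nat \<Rightarrow> nat" where
  "r3 N = Max (card ` {S. S \<subseteq> {1..int N} \<and> three_AP_free S})"

end

theory Submission
  imports Defs "HOL-Number_Theory.Number_Theory" "HOL-Real_Asymp.Real_Asymp"
begin

text \<open>
  Behrend's construction places points of a product of cyclic groups in a box of side one half in
  every coordinate, where arithmetic progressions do not wrap around, and keeps those on which a
  strictly convex quadratic function is constant. The density of the box is \<open>1/4\<close> per pair of
  coordinates. Here the square is replaced by a set of density \<open>9/32\<close> in
  \<open>\<int>/p \<times> \<int>/q\<close>, with \<open>p\<close> and \<open>q\<close> odd, in which some progressions do wrap around, but
  which carries a function \<open>F\<close> of size \<open>O(p\<^sup>2 + q\<^sup>2)\<close> with \<open>F x + F z > 2 F y\<close> for every
  nontrivial progression \<open>x, y, z\<close>. In coordinates \<open>a, b\<close> rescaled to the unit torus the set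
  consists of a triangle \<open>a < 2b, b < 1/4\<close> and of the even residues \<open>a\<close> with
  \<open>a \<ge> 2b - 1, 1/4 < b < 3/4\<close>; their densities are \<open>1/16\<close> and \<open>7/32\<close>.

  A product of \<open>m\<close> such sets, for \<open>2m\<close> pairwise coprime odd moduli with product close to \<open>N\<close>, is
  a subset of a cyclic group by the Chinese remainder theorem, and a most popular value of the sum
  of the \<open>m\<close> functions \<open>F\<close> gives a progression-free set of size about \<open>(9/32)\<^sup>m N\<^sup>1\<^sup>-\<^sup>1\<^sup>/\<^sup>m\<close>. The
  choice \<open>m \<approx> sqrt (log N / log (32/9))\<close> is optimal. As moduli serve powers of distinct odd
  primes; they need to agree only up to a factor polynomial in \<open>m\<close>.
\<close>

subsection \<open>A dense planar set with a midpoint convex function\<close>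

text \<open>The strip of width \<open>2w\<close> around \<open>b = q/4\<close> is left out so that the kink of \<open>height\<close> at
  \<open>q div 4\<close> contributes at least \<open>l * w\<close> to every progression meeting both parts.\<close>

definition planar_set :: "int \<Rightarrow> int \<Rightarrow> int \<Rightarrow> (int \<times> int) set" where
  "planar_set p q w =
     {(a, b). 0 \<le> a \<and> a < p \<and> 0 \<le> b \<and> b + w \<le> q div 4 \<and> q * a < 2 * p * b} \<union>
     {(a, b). 0 \<le> a \<and> a < p \<and> even a \<and> q div 4 + w \<le> b \<and> 4 * b < 3 * q \<and> p * (2 * b - q) \<le> q * a}"

text \<open>The squares are strictly convex along progressions that do not wrap around. The hinge in
  \<open>b\<close>, with a large weight \<open>l\<close>, makes up for the rest: its gain outweighs
  any possible loss in the squares.\<close>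

definition height :: "int \<Rightarrow> int \<Rightarrow> int \<times> int \<Rightarrow> int" where
  "height q l = (\<lambda>(a, b). a\<^sup>2 + b\<^sup>2 + l * max 0 (q div 4 - b))"

lemma cong_multiple_cases:
  fixes d q :: int
  assumes "[d = 0] (mod q)" "- 2 * q < d" "d < 2 * q" "0 < q"
  shows "d = - q \<or> d = 0 \<or> d = q"
proof -
  obtain k where k: "d = q * k" using assms(1) by (auto simp: cong_0_iff)
  have "- 2 < k" 
  proof (rule ccontr)
    assume "\<not> - 2 < k" then have "q * k \<le> q * (- 2)" using assms(4) by (intro mult_left_mono) auto
    then show False using assms k by simp
  qed
  moreover have "k < 2"
  proof (rule ccontr)
    assume "\<not> k < 2" then have "q * 2 \<le> q * k" using assms(4) by (intro mult_left_mono) auto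
    then show False using assms k by simp
  qed
  ultimately have "k = -1 \<or> k = 0 \<or> k = 1" by auto
  then show ?thesis using k by auto
qed

lemma sum_squares_midpoint:
  fixes a1 a2 a3 :: int
  assumes "a1 + a3 = 2 * a2"
  shows "a1\<^sup>2 + a3\<^sup>2 = 2 * a2\<^sup>2 + 2 * (a1 - a2)\<^sup>2"
proof -
  have a3: "a3 = 2 * a2 - a1" using assms by simp
  show ?thesis unfolding a3 by (simp add: power2_eq_square algebra_simps)
qed

text \<open>Case distinction on the wraparound of \<open>b\<close>, which is \<open>-q\<close>,
  \<open>0\<close> or \<open>q\<close>. Three mechanisms suffice: a hinge gain of \<open>w\<close>,
  which \<open>lw\<close> turns into more than twice the largest square sum; parity, since points of
  the second part have even \<open>a\<close> while \<open>p\<close> is odd; and the parallelogram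
  identity when nothing wraps and the hinge is affine along the progression.\<close>

lemma height_midpoint_convex:
  fixes p q w l :: int
  assumes "odd p" "0 < p" "0 < q" "0 < w" "0 \<le> l" and lw: "2 * (p\<^sup>2 + q\<^sup>2) < l * w"
    and x: "(a1, b1) \<in> planar_set p q w" and y: "(a2, b2) \<in> planar_set p q w"
    and z: "(a3, b3) \<in> planar_set p q w"
    and ca: "[a1 + a3 = 2 * a2] (mod p)" and cb: "[b1 + b3 = 2 * b2] (mod q)"
  shows "2 * height q l (a2, b2) < height q l (a1, b1) + height q l (a3, b3)
    \<or> a1 = a2 \<and> b1 = b2 \<and> a2 = a3 \<and> b2 = b3"
proof -
  define c where "c = q div 4"
  have c: "4 * c \<le> q" "q < 4 * c + 4" unfolding c_def by linarith+
  define E where "E = (\<lambda>(a, b). 0 \<le> a \<and> a < p \<and> 0 \<le> b \<and> b + w \<le> c \<and> q * a < 2 * p * b)"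
  define F where "F = (\<lambda>(a, b). 0 \<le> a \<and> a < p \<and> even a \<and> c + w \<le> b \<and> 4 * b < 3 * q \<and> p * (2 * b - q) \<le> q * a)"
  have EF: "s \<in> planar_set p q w \<longleftrightarrow> E s \<or> F s" for s
    by (auto simp: planar_set_def E_def F_def c_def)
  define h where "h = (\<lambda>b. max 0 (c - b))"
  have height: "height q l (a, b) = a\<^sup>2 + b\<^sup>2 + l * h b" for a b
    by (simp add: height_def h_def c_def)
  have h0: "0 \<le> h b" for b by (simp add: h_def)
  have range: "0 \<le> a \<and> a < p \<and> 0 \<le> b \<and> 4 * b < 3 * q" if "(a, b) \<in> planar_set p q w" for a b
    using that c assms(3,4) by (auto simp: EF E_def F_def)
  have rx: "0 \<le> a1 \<and> a1 < p \<and> 0 \<le> b1 \<and> 4 * b1 < 3 * q"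
    and ry: "0 \<le> a2 \<and> a2 < p \<and> 0 \<le> b2 \<and> 4 * b2 < 3 * q"
    and rz: "0 \<le> a3 \<and> a3 < p \<and> 0 \<le> b3 \<and> 4 * b3 < 3 * q"
    using range x y z by blast+
  have gain: "2 * height q l (a2, b2) < height q l (a1, b1) + height q l (a3, b3)"
    if g: "w \<le> h b1 + h b3 - 2 * h b2"
  proof -
    have "a2\<^sup>2 \<le> p\<^sup>2" "b2\<^sup>2 \<le> q\<^sup>2" using ry by (auto intro!: power_mono)
    moreover have "l * w \<le> l * h b1 + l * h b3 - 2 * (l * h b2)"
      using mult_left_mono[OF g assms(5)] by (simp add: algebra_simps)
    moreover have "0 \<le> a1\<^sup>2" "0 \<le> a3\<^sup>2" "0 \<le> b1\<^sup>2" "0 \<le> b3\<^sup>2" by simp_all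
    ultimately show ?thesis using lw unfolding height distrib_left by linarith
  qed
  have nonwrap: "2 * height q l (a2, b2) < height q l (a1, b1) + height q l (a3, b3)
      \<or> a1 = a2 \<and> b1 = b2 \<and> a2 = a3 \<and> b2 = b3"
    if "b1 + b3 = 2 * b2" "a1 + a3 = 2 * a2" "2 * h b2 = h b1 + h b3"
  proof (cases "a1 = a2 \<and> b1 = b2")
    case True
    then show ?thesis using that by auto
  next
    case False
    then have "0 < (a1 - a2)\<^sup>2 + (b1 - b2)\<^sup>2"
      by (metis eq_iff_diff_eq_0 sum_power2_gt_zero_iff)
    moreover have "l * h b1 + l * h b3 = 2 * (l * h b2)"
      using that(3) by (metis distrib_left mult.left_commute)
    ultimately show ?thesis
      using sum_squares_midpoint[OF that(1)] sum_squares_midpoint[OF that(2)]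
      unfolding height distrib_left by linarith
  qed
  have "[b1 + b3 - 2 * b2 = 0] (mod q)" using cb by (simp add: cong_diff_iff_cong_0)
  then consider "b1 + b3 - 2 * b2 = - q" | "b1 + b3 - 2 * b2 = 0" | "b1 + b3 - 2 * b2 = q"
    using cong_multiple_cases[of "b1 + b3 - 2 * b2" q] rx ry rz \<open>0 < q\<close> by force
  then show ?thesis
  proof cases
    case 1
    \<comment> \<open>Here \<open>b2 \<ge> q/2\<close>, while \<open>b1\<close> and \<open>b3\<close> cannot both be at least \<open>q/4\<close>.\<close>
    have "h b2 = 0" using 1 c rx rz by (auto simp: h_def)
    moreover have "w \<le> h b1 \<or> w \<le> h b3"
      using x z 1 c rx ry rz by (auto simp: EF E_def F_def h_def)
    ultimately have "w \<le> h b1 + h b3 - 2 * h b2" using h0[of b1] h0[of b3] by linarith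
    then show ?thesis using gain by blast
  next
    case 3
    \<comment> \<open>Excluded: the bounds on \<open>a\<close> leave only \<open>a1 + a3 - 2 * a2 = p\<close>, and the left side is even.\<close>
    have Fx: "F (a1, b1)" and Fz: "F (a3, b3)" and Ey: "E (a2, b2)"
      using x y z 3 c rx ry rz \<open>0 < w\<close> by (auto simp: EF E_def F_def)
    \<comment> \<open>The line bounding the second part is a translate of the one bounding the
      first, so the shift of \<open>b1 + b3\<close> by \<open>q\<close> cancels: the endpoints force
      \<open>a1 + a3\<close> to be at least \<open>4 * p * b2 / q\<close>, and the midpoint keeps
      \<open>2 * a2\<close> strictly below that.\<close>
    have "p * (2 * b1 - q) + p * (2 * b3 - q) \<le> q * (a1 + a3)"
      using Fx Fz by (simp add: F_def algebra_simps)
    moreover have "(2 * b1 - q) + (2 * b3 - q) = 4 * b2" using 3 by simp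
    then have "p * (2 * b1 - q) + p * (2 * b3 - q) = p * (4 * b2)" by (metis distrib_left)
    moreover have "q * (2 * a2) < p * (4 * b2)" using Ey by (simp add: E_def algebra_simps)
    ultimately have "q * (2 * a2) < q * (a1 + a3)" by linarith
    then have "0 < a1 + a3 - 2 * a2" using \<open>0 < q\<close> by (simp add: mult_less_cancel_left)
    moreover have "[a1 + a3 - 2 * a2 = 0] (mod p)" using ca by (simp add: cong_diff_iff_cong_0)
    ultimately have "a1 + a3 - 2 * a2 = p"
      using cong_multiple_cases[of "a1 + a3 - 2 * a2" p] rx ry rz \<open>0 < p\<close> by force
    moreover have "even (a1 + a3 - 2 * a2)" using Fx Fz by (simp add: F_def)
    ultimately show ?thesis using \<open>odd p\<close> by simp
  next
    case 2
    have ca0: "[a1 + a3 - 2 * a2 = 0] (mod p)" using ca by (simp add: cong_diff_iff_cong_0)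
    have a_cases: "a1 + a3 - 2 * a2 = - p \<or> a1 + a3 - 2 * a2 = 0 \<or> a1 + a3 - 2 * a2 = p"
      using cong_multiple_cases[OF ca0] rx ry rz \<open>0 < p\<close> by force
    \<comment> \<open>If both parts occur, the endpoints lie in different parts, because
      \<open>b2\<close> is the true midpoint of \<open>b1\<close> and \<open>b3\<close>. Both are at
      distance at least \<open>w\<close> from the kink at \<open>c\<close>, and the second
      difference of \<open>h\<close> is the distance from the kink of the endpoint in the part not
      containing the midpoint.\<close>
    consider "E (a1, b1)" "E (a2, b2)" "E (a3, b3)" | "F (a1, b1)" "F (a2, b2)" "F (a3, b3)"
      | "w \<le> h b1 + h b3 - 2 * h b2"
      using x y z 2 \<open>0 < w\<close> by (auto simp: EF E_def F_def h_def)
    then show ?thesis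
    proof cases
      case 1
      \<comment> \<open>In the triangle \<open>b\<close> is below \<open>q / 4\<close>, so
        \<open>a\<close> stays below \<open>p / 2\<close> and the first coordinates cannot
        wrap.\<close>
      have small: "2 * a < p" if "E (a, b)" for a b
      proof -
        have "q * (2 * a) < p * (4 * b)" "4 * b \<le> q" using that c \<open>0 < w\<close> by (auto simp: E_def algebra_simps)
        moreover have "p * (4 * b) \<le> p * q" using \<open>4 * b \<le> q\<close> \<open>0 < p\<close> by simp
        ultimately have "q * (2 * a) < q * p" unfolding mult.commute[of q p] by linarith
        then show ?thesis using \<open>0 < q\<close> by (simp add: mult_less_cancel_left)
      qed
      have "a1 + a3 = 2 * a2" using a_cases small[OF 1(1)] small[OF 1(2)] small[OF 1(3)] rx ry rz by auto
      moreover have "2 * h b2 = h b1 + h b3" using 1 2 \<open>0 < w\<close> by (auto simp: E_def h_def)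
      ultimately show ?thesis using nonwrap 2 by simp
    next
      case 2
      have "even (a1 + a3 - 2 * a2)" using 2 by (simp add: F_def)
      then have "a1 + a3 - 2 * a2 \<noteq> - p" "a1 + a3 - 2 * a2 \<noteq> p" using \<open>odd p\<close> by (metis even_minus)+
      then have "a1 + a3 = 2 * a2" using a_cases by linarith
      moreover have "2 * h b2 = h b1 + h b3" using 2 \<open>0 < w\<close> by (auto simp: F_def h_def)
      ultimately show ?thesis using nonwrap \<open>b1 + b3 - 2 * b2 = 0\<close> by simp
    next
      case 3
      then show ?thesis using gain by blast
    qed
  qed
qed

subsection \<open>Products and level sets\<close>

text \<open>The interface between the planar set and the final count. It passes to products of
  coprime moduli, and on a level set of \<open>F\<close> the strict inequality is impossible, so
  only trivial progressions modulo \<open>Q\<close> remain.\<close>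

definition midpoint_convex_mod :: "int \<Rightarrow> int set \<Rightarrow> (int \<Rightarrow> int) \<Rightarrow> bool" where
  "midpoint_convex_mod Q U F \<longleftrightarrow> U \<subseteq> {0..<Q} \<and>
     (\<forall>x\<in>U. \<forall>y\<in>U. \<forall>z\<in>U. [x + z = 2 * y] (mod Q) \<longrightarrow> 2 * F y < F x + F z \<or> x = y \<and> y = z)"

lemma midpoint_convex_modD:
  assumes "midpoint_convex_mod Q U F" "x \<in> U" "y \<in> U" "z \<in> U" "[x + z = 2 * y] (mod Q)"
  shows "2 * F y < F x + F z \<or> x = y \<and> y = z"
  using assms unfolding midpoint_convex_mod_def by blast

text \<open>The Chinese remainder theorem; surjectivity follows from injectivity and equal
  cardinalities.\<close>

lemma bij_betw_residue_pairs:
  fixes P Q :: int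
  assumes "coprime P Q" "0 < P" "0 < Q"
  shows "bij_betw (\<lambda>n. (n mod P, n mod Q)) {0..<P * Q} ({0..<P} \<times> {0..<Q})"
proof -
  have inj: "inj_on (\<lambda>n. (n mod P, n mod Q)) {0..<P * Q}"
  proof (rule inj_onI)
    fix m n assume mn: "m \<in> {0..<P * Q}" "n \<in> {0..<P * Q}" "(m mod P, m mod Q) = (n mod P, n mod Q)"
    then have "[m = n] (mod P)" "[m = n] (mod Q)" by (simp_all add: unique_euclidean_semiring_class.cong_def)
    then have "[m = n] (mod P * Q)" using assms(1) by (rule coprime_cong_mult)
    then show "m = n" using mn(1,2) by (auto simp: unique_euclidean_semiring_class.cong_def)
  qed
  have "(\<lambda>n. (n mod P, n mod Q)) ` {0..<P * Q} \<subseteq> {0..<P} \<times> {0..<Q}" using assms by auto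
  moreover have "card ((\<lambda>n. (n mod P, n mod Q)) ` {0..<P * Q}) = card ({0..<P} \<times> {0..<Q})"
    using assms by (simp add: card_image[OF inj] card_cartesian_product nat_mult_distrib)
  ultimately have "(\<lambda>n. (n mod P, n mod Q)) ` {0..<P * Q} = {0..<P} \<times> {0..<Q}"
    by (intro card_subset_eq) auto
  then show ?thesis using inj by (simp add: bij_betw_def)
qed

lemma card_residue_pairs:
  fixes P Q :: int
  assumes "coprime P Q" "0 < P" "0 < Q" "S \<subseteq> {0..<P} \<times> {0..<Q}"
  shows "card {n \<in> {0..<P * Q}. (n mod P, n mod Q) \<in> S} = card S"
proof (rule bij_betw_same_card)
  have *: "(\<lambda>n. (n mod P, n mod Q)) ` {n \<in> {0..<P * Q}. (n mod P, n mod Q) \<in> S} = S" (is "?f ` ?A = S")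
  proof
    show "S \<subseteq> ?f ` ?A"
    proof
      fix s assume s: "s \<in> S"
      then have "s \<in> ?f ` {0..<P * Q}"
        using bij_betw_residue_pairs[OF assms(1-3)] assms(4) by (auto simp: bij_betw_def)
      then show "s \<in> ?f ` ?A" using s by auto
    qed
  qed auto
  show "bij_betw ?f ?A S"
    by (rule bij_betw_subset[OF bij_betw_residue_pairs[OF assms(1-3)] _ *]) auto
qed

lemma residue_pair_inject:
  fixes P Q :: int
  assumes "coprime P Q" "0 < P" "0 < Q" "m \<in> {0..<P * Q}" "n \<in> {0..<P * Q}"
    "m mod P = n mod P" "m mod Q = n mod Q"
  shows "m = n"
  using bij_betw_residue_pairs[OF assms(1-3)] assms(4-) by (auto simp: bij_betw_def inj_on_def)

lemma cong_midpoint_mod: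
  fixes x y z Q D :: int
  assumes "[x + z = 2 * y] (mod Q)" "D dvd Q"
  shows "[x mod D + z mod D = 2 * (y mod D)] (mod D)"
proof -
  have "[x + z = 2 * y] (mod D)" using assms by (rule cong_dvd_modulus)
  then show ?thesis by (simp add: unique_euclidean_semiring_class.cong_def mod_simps)
qed

text \<open>A progression modulo \<open>P * Q\<close> reduces to one in each factor. Each factor
  contributes strict inequality or equality, so the sum is strict unless both reductions are
  trivial, and then the residues modulo \<open>P * Q\<close> coincide.\<close>

lemma midpoint_convex_mod_mult:
  assumes "midpoint_convex_mod P U F" "midpoint_convex_mod Q V G" "coprime P Q" "0 < P" "0 < Q"
  defines "W \<equiv> {n \<in> {0..<P * Q}. (n mod P, n mod Q) \<in> U \<times> V}"
  shows "midpoint_convex_mod (P * Q) W (\<lambda>n. F (n mod P) + G (n mod Q))" "card W = card U * card V"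
proof -
  show "card W = card U * card V"
    unfolding W_def using assms(1,2)
    by (subst card_residue_pairs[OF assms(3-5)]) (auto simp: midpoint_convex_mod_def card_cartesian_product)
  show "midpoint_convex_mod (P * Q) W (\<lambda>n. F (n mod P) + G (n mod Q))"
    unfolding midpoint_convex_mod_def
  proof (intro conjI ballI impI)
    fix x y z assume W: "x \<in> W" "y \<in> W" "z \<in> W" and c: "[x + z = 2 * y] (mod P * Q)"
    have "2 * F (y mod P) < F (x mod P) + F (z mod P) \<or> x mod P = y mod P \<and> y mod P = z mod P"
      by (rule midpoint_convex_modD[OF assms(1) _ _ _ cong_midpoint_mod[OF c]]) (use W in \<open>auto simp: W_def\<close>)
    moreover have "2 * G (y mod Q) < G (x mod Q) + G (z mod Q) \<or> x mod Q = y mod Q \<and> y mod Q = z mod Q"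
      by (rule midpoint_convex_modD[OF assms(2) _ _ _ cong_midpoint_mod[OF c]]) (use W in \<open>auto simp: W_def\<close>)
    ultimately show "2 * (F (y mod P) + G (y mod Q)) < F (x mod P) + G (x mod Q) + (F (z mod P) + G (z mod Q)) \<or> x = y \<and> y = z"
      using W residue_pair_inject[OF assms(3-5), of x y] residue_pair_inject[OF assms(3-5), of y z]
      unfolding W_def by force
  qed (auto simp: W_def)
qed

lemma midpoint_convex_mod_planar:
  fixes p q w l :: int
  assumes "odd p" "coprime p q" "0 < p" "0 < q" "0 < w" "0 \<le> l" "2 * (p\<^sup>2 + q\<^sup>2) < l * w"
  defines "U \<equiv> {n \<in> {0..<p * q}. (n mod p, n mod q) \<in> planar_set p q w}"
  shows "midpoint_convex_mod (p * q) U (\<lambda>n. height q l (n mod p, n mod q))"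
    "card U = card (planar_set p q w)"
proof -
  have sub: "planar_set p q w \<subseteq> {0..<p} \<times> {0..<q}"
    using assms(4,5) by (auto simp: planar_set_def)
  show "card U = card (planar_set p q w)"
    unfolding U_def by (rule card_residue_pairs[OF assms(2-4) sub])
  show "midpoint_convex_mod (p * q) U (\<lambda>n. height q l (n mod p, n mod q))"
    unfolding midpoint_convex_mod_def
  proof (intro conjI ballI impI)
    fix x y z assume U: "x \<in> U" "y \<in> U" "z \<in> U" and c: "[x + z = 2 * y] (mod p * q)"
    have "2 * height q l (y mod p, y mod q) < height q l (x mod p, x mod q) + height q l (z mod p, z mod q)
      \<or> x mod p = y mod p \<and> x mod q = y mod q \<and> y mod p = z mod p \<and> y mod q = z mod q"
      by (rule height_midpoint_convex[OF assms(1,3-7)])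
        (use U cong_midpoint_mod[OF c, of p] cong_midpoint_mod[OF c, of q] in \<open>auto simp: U_def\<close>)
    then show "2 * height q l (y mod p, y mod q) < height q l (x mod p, x mod q) + height q l (z mod p, z mod q) \<or> x = y \<and> y = z"
      using U residue_pair_inject[OF assms(2-4), of x y] residue_pair_inject[OF assms(2-4), of y z]
      unfolding U_def by blast
  qed (auto simp: U_def)
qed

lemma midpoint_convex_mod_prod:
  fixes M :: "nat \<Rightarrow> int" and \<kappa> R :: real
  assumes "\<And>j. j < m \<Longrightarrow> \<exists>U F. midpoint_convex_mod (M j) U F \<and> \<kappa> * M j \<le> card U \<and> (\<forall>n\<in>U. 0 \<le> F n \<and> F n \<le> R)"
    and "\<And>j. j < m \<Longrightarrow> 0 < M j" and "\<And>i j. j < m \<Longrightarrow> i < j \<Longrightarrow> coprime (M i) (M j)" and "0 \<le> \<kappa>"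
  shows "\<exists>U F. midpoint_convex_mod (\<Prod>j<m. M j) U F \<and> \<kappa> ^ m * (\<Prod>j<m. M j) \<le> card U
    \<and> (\<forall>n\<in>U. 0 \<le> F n \<and> F n \<le> m * R)"
  using assms
proof (induction m)
  case 0
  show ?case
    by (rule exI[of _ "{0}"], rule exI[of _ "\<lambda>_. 0"]) (auto simp: midpoint_convex_mod_def)
next
  case (Suc m)
  let ?P = "\<Prod>j<m. M j"
  have "\<exists>U F. midpoint_convex_mod ?P U F \<and> \<kappa> ^ m * ?P \<le> card U \<and> (\<forall>n\<in>U. 0 \<le> F n \<and> F n \<le> m * R)"
    by (rule Suc.IH) (use Suc.prems in auto)
  then obtain U F where U: "midpoint_convex_mod ?P U F" "\<kappa> ^ m * ?P \<le> card U" "\<forall>n\<in>U. 0 \<le> F n \<and> F n \<le> m * R"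
    by blast
  obtain V G where V: "midpoint_convex_mod (M m) V G" "\<kappa> * M m \<le> card V" "\<forall>n\<in>V. 0 \<le> G n \<and> G n \<le> R"
    using Suc.prems(1)[of m] by auto
  have co: "coprime ?P (M m)" using Suc.prems(3)[of m] by (auto intro: prod_coprime_left)
  have pos: "0 < ?P" "0 < M m" using Suc.prems(2) by (auto intro: prod_pos)
  define W where "W = {n \<in> {0..<?P * M m}. (n mod ?P, n mod M m) \<in> U \<times> V}"
  define H where "H = (\<lambda>n. F (n mod ?P) + G (n mod M m))"
  note W = midpoint_convex_mod_mult[OF U(1) V(1) co pos, folded W_def H_def]
  have "(\<kappa> ^ m * ?P) * (\<kappa> * M m) \<le> real (card U) * real (card V)"
    using U(2) V(2) Suc.prems(4) pos by (intro mult_mono) auto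
  then have "\<kappa> ^ Suc m * (\<Prod>j<Suc m. M j) \<le> card W" using W(2) by (simp add: mult_ac)
  moreover have "0 \<le> H n \<and> H n \<le> Suc m * R" if "n \<in> W" for n
  proof -
    have "0 \<le> F (n mod ?P)" "F (n mod ?P) \<le> m * R" "0 \<le> G (n mod M m)" "G (n mod M m) \<le> R"
      using that U(3) V(3) by (auto simp: W_def)
    then show ?thesis by (simp add: H_def algebra_simps)
  qed
  ultimately show ?case using W(1) by auto
qed

lemma card_le_r3:
  assumes "S \<subseteq> {1..int N}" "three_AP_free S"
  shows "card S \<le> r3 N"
  unfolding r3_def
proof (rule Max_ge)
  have "{S. S \<subseteq> {1..int N} \<and> three_AP_free S} \<subseteq> Pow {1..int N}" by auto
  then show "finite (card ` {S. S \<subseteq> {1..int N} \<and> three_AP_free S})"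
    by (meson finite_Pow_iff finite_atLeastAtMost_int finite_imageI finite_subset)
qed (use assms in auto)

text \<open>Pigeonhole: the integer-valued \<open>F\<close> has at most \<open>floor R + 1\<close>
  level sets on \<open>U\<close>, and each is free of progressions.\<close>

lemma r3_ge_of_midpoint_convex_mod:
  fixes R :: real
  assumes conv: "midpoint_convex_mod Q U F" and F: "\<And>n. n \<in> U \<Longrightarrow> 0 \<le> F n \<and> F n \<le> R"
    and "0 \<le> R" "Q \<le> int N"
  shows "card U \<le> (R + 1) * r3 N"
proof -
  have U: "U \<subseteq> {0..<Q}" using conv by (simp add: midpoint_convex_mod_def)
  then have finU: "finite U" using finite_subset by blast
  have level: "card {n \<in> U. F n = v} \<le> r3 N" for v
  proof -
    \<comment> \<open>The shift by 1 moves residues from \<open>{0..<Q}\<close> into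
      \<open>{1..int N}\<close>.\<close>
    let ?S = "(\<lambda>n. n + 1) ` {n \<in> U. F n = v}"
    have "three_AP_free ?S"
      unfolding three_AP_free_def
    proof (intro ballI impI)
      fix x y z assume S: "x \<in> ?S" "y \<in> ?S" "z \<in> ?S" and e: "2 * y = x + z"
      then have "[(x - 1) + (z - 1) = 2 * (y - 1)] (mod Q)" by simp
      moreover have "x - 1 \<in> U" "y - 1 \<in> U" "z - 1 \<in> U" "F (x - 1) = v" "F (y - 1) = v" "F (z - 1) = v"
        using S by auto
      ultimately show "x = y \<and> y = z"
        using midpoint_convex_modD[OF conv, of "x - 1" "y - 1" "z - 1"] by simp
    qed
    moreover have "?S \<subseteq> {1..int N}" using U assms(4) by force
    ultimately have "card ?S \<le> r3 N" by (rule card_le_r3[rotated])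
    then show ?thesis by (simp add: card_image)
  qed
  have "U = (\<Union>v\<in>{0..\<lfloor>R\<rfloor>}. {n \<in> U. F n = v})" using F by (auto simp: le_floor_iff)
  then have "card U = card (\<Union>v\<in>{0..\<lfloor>R\<rfloor>}. {n \<in> U. F n = v})" by (rule arg_cong)
  also have "\<dots> \<le> (\<Sum>v\<in>{0..\<lfloor>R\<rfloor>}. card {n \<in> U. F n = v})" by (rule card_UN_le) simp
  also have "\<dots> \<le> (\<Sum>v\<in>{0..\<lfloor>R\<rfloor>}. r3 N)" by (intro sum_mono level)
  also have "\<dots> = nat (\<lfloor>R\<rfloor> + 1) * r3 N" by simp
  finally have "real (card U) \<le> real (nat (\<lfloor>R\<rfloor> + 1) * r3 N)" by (simp only: of_nat_le_iff)
  also have "\<dots> = (of_int \<lfloor>R\<rfloor> + 1) * real (r3 N)" using assms(3) by simp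
  also have "\<dots> \<le> (R + 1) * real (r3 N)" by (intro mult_right_mono) auto
  finally show ?thesis .
qed

subsection \<open>The density of the planar set\<close>

text \<open>For \<open>4 * b \<le> q\<close> the slope condition already implies
  \<open>a < p\<close>, so every integer from 0 up to the real bound \<open>2 * p * b / q\<close>
  counts.\<close>

lemma card_lower_fibre:
  fixes p q b :: int
  assumes "0 < p" "0 < q" "0 \<le> b" "4 * b \<le> q"
  shows "2 * p * b / q \<le> card {a. 0 \<le> a \<and> a < p \<and> q * a < 2 * p * b}"
proof -
  let ?r = "real_of_int (2 * p * b) / real_of_int q"
  have "{0..<\<lceil>?r\<rceil>} \<subseteq> {a. 0 \<le> a \<and> a < p \<and> q * a < 2 * p * b}"
  proof
    fix a assume a: "a \<in> {0..<\<lceil>?r\<rceil>}"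
    then have "real_of_int a < ?r" by (simp add: less_ceiling_iff)
    then have "real_of_int (q * a) < real_of_int (2 * p * b)" using assms(2) by (simp add: field_simps)
    then have 1: "q * a < 2 * p * b" by (simp only: of_int_less_iff)
    have "p * (2 * b) \<le> p * q" using assms by (intro mult_left_mono) auto
    then have "q * a < q * p" using 1 by (simp add: algebra_simps)
    then have "a < p" using assms(2) by simp
    then show "a \<in> {a. 0 \<le> a \<and> a < p \<and> q * a < 2 * p * b}" using a 1 by simp
  qed
  moreover have "finite {a. 0 \<le> a \<and> a < p \<and> q * a < 2 * p * b}"
    by (rule finite_subset[of _ "{0..<p}"]) auto
  ultimately have "card {0..<\<lceil>?r\<rceil>} \<le> card {a. 0 \<le> a \<and> a < p \<and> q * a < 2 * p * b}"
    by (intro card_mono)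
  moreover have "?r \<le> card {0..<\<lceil>?r\<rceil>}" by (simp add: of_nat_ceiling)
  ultimately show ?thesis by linarith
qed

lemma card_upper_fibre:
  fixes p q b :: int
  assumes "0 < p" "0 < q"
  shows "p * (1 / 2 - max 0 (b - q / 2) / q) - 1
    \<le> real (card {a. 0 \<le> a \<and> a < p \<and> even a \<and> p * (2 * b - q) \<le> q * a})" (is "_ \<le> real (card ?A)")
proof -
  \<comment> \<open>With \<open>a = 2 * j\<close> the two conditions become \<open>r \<le> j\<close>
    and \<open>j < p / 2\<close>; the maximum with 0 covers \<open>b < q / 2\<close>, where the
    slope condition is void. Rounding costs at most 1.\<close>
  define r where "r = p * max 0 (real_of_int b - q / 2) / q"
  have r0: "0 \<le> r" using assms by (simp add: r_def)
  have "(\<lambda>j. 2 * j) ` {\<lceil>r\<rceil>..<\<lceil>real_of_int p / 2\<rceil>} \<subseteq> ?A"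
  proof (clarsimp, intro conjI)
    fix j assume j: "\<lceil>r\<rceil> \<le> j" "j < \<lceil>real_of_int p / 2\<rceil>"
    have rj: "r \<le> j" using j(1) by (simp add: ceiling_le_iff)
    then show "0 \<le> j" using r0 by linarith
    have "real_of_int j < p / 2" using j(2) by (simp add: less_ceiling_iff)
    then show "2 * j < p" by linarith
    have "real_of_int p * (b - q / 2) \<le> q * r"
      using assms by (simp add: r_def)
    also have "\<dots> \<le> q * j" using rj assms by simp
    finally have "real_of_int (p * (2 * b - q)) \<le> real_of_int (q * (2 * j))" by (simp add: algebra_simps)
    then show "p * (2 * b - q) \<le> q * (2 * j)" by (simp only: of_int_le_iff)
  qed
  moreover have "finite ?A" by (rule finite_subset[of _ "{0..<p}"]) auto
  ultimately have "card ((\<lambda>j. 2 * j) ` {\<lceil>r\<rceil>..<\<lceil>real_of_int p / 2\<rceil>}) \<le> card ?A" by (intro card_mono)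
  moreover have "card ((\<lambda>j::int. 2 * j) ` {\<lceil>r\<rceil>..<\<lceil>real_of_int p / 2\<rceil>}) = nat (\<lceil>real_of_int p / 2\<rceil> - \<lceil>r\<rceil>)"
    by (subst card_image) (auto simp: inj_on_def)
  moreover have "p / 2 - r - 1 \<le> \<lceil>real_of_int p / 2\<rceil> - \<lceil>r\<rceil>" by linarith
  moreover have "real_of_int (\<lceil>real_of_int p / 2\<rceil> - \<lceil>r\<rceil>) \<le> nat (\<lceil>real_of_int p / 2\<rceil> - \<lceil>r\<rceil>)" by linarith
  ultimately have "p / 2 - r - 1 \<le> card ?A" by linarith
  then show ?thesis by (simp add: r_def algebra_simps)
qed

text \<open>\<open>G\<close> acts as a discrete antiderivative, so sums of fibre sizes can be
  bounded by closed forms.\<close>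

lemma sum_int_telescope_le:
  fixes g G :: "int \<Rightarrow> real"
  assumes "s \<le> e" "\<And>b. s \<le> b \<Longrightarrow> b < e \<Longrightarrow> G (b + 1) - G b \<le> g b"
  shows "G e - G s \<le> (\<Sum>b\<in>{s..<e}. g b)"
  using assms
proof (induction e rule: int_ge_induct)
  case (step e)
  have "{s..<e + 1} = insert e {s..<e}" using step by auto
  moreover have "G e - G s \<le> sum g {s..<e}" using step.IH step.prems by simp
  moreover have "G (e + 1) - G e \<le> g e" using step.prems step.hyps by simp
  ultimately show ?case by simp
qed auto

text \<open>The two parts have densities 1/16 and 7/32. Removing the strip costs about
  \<open>\<eta> * p * q / 2\<close> in each, and the rounding terms, in total
  \<open>3 * p / 2 + q\<close>, fit into another \<open>\<eta> * p * q\<close> because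
  \<open>\<eta> * p\<close> and \<open>\<eta> * q\<close> are at least 3.\<close>

lemma card_planar_set_ge:
  fixes p q w :: int and \<eta> :: real
  assumes "0 < \<eta>" "\<eta> \<le> 1 / 16" "3 / \<eta> \<le> p" "3 / \<eta> \<le> q" "0 < w" "w \<le> \<eta> * q + 1"
  shows "(9 / 32 - 2 * \<eta>) * (p * q) \<le> card (planar_set p q w)"
proof -
  define c where "c = q div 4"
  have c: "4 * c \<le> q" "q < 4 * c + 4" unfolding c_def by linarith+
  have "48 \<le> 3 / \<eta>" using assms(1,2) by (simp add: field_simps)
  then have pq: "48 \<le> p" "48 \<le> q" using assms(3,4) by linarith+
  have \<eta>pq: "3 \<le> \<eta> * p" "3 \<le> \<eta> * q" using assms(1,3,4) by (simp_all add: field_simps)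
  define e where "e = \<lceil>3 * real_of_int q / 4\<rceil>"
  have e: "4 * b < 3 * q" if "b < e" for b
    using that by (simp add: e_def less_ceiling_iff)
  have e': "3 * q / 4 \<le> e" "e \<le> q" unfolding e_def using pq by linarith+
  define A where "A b = {a. 0 \<le> a \<and> a < p \<and> q * a < 2 * p * b}" for b
  define A' where "A' b = {a. 0 \<le> a \<and> a < p \<and> even a \<and> p * (2 * b - q) \<le> q * a}" for b
  have fin: "finite (A b)" "finite (A' b)" for b
    by (rule finite_subset[of _ "{0..<p}"]; auto simp: A_def A'_def)+
  let ?X = "Sigma {0..<c - w + 1} A" and ?Y = "Sigma {c + w..<e} A'"
  have "\<eta> * q \<le> q / 16" using assms(2) pq by (simp add: field_simps)
  then have wq: "w \<le> q / 16 + 1" using assms(6) by linarith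
  have cw: "q / 4 - \<eta> * q - 2 \<le> c - w" "0 \<le> q / 4 - \<eta> * q - 2" "c + w \<le> q / 4 + \<eta> * q + 1" "0 \<le> c - w" "c + w \<le> e" "c + w \<le> q / 2"
    using c assms(6) pq \<open>\<eta> * q \<le> q / 16\<close> e' wq by linarith+
  have X: "p * (q / 16 - (\<eta> * q + 2) / 2) \<le> card ?X"
  proof -
    \<comment> \<open>The exact discrete antiderivative of the fibre bound
      \<open>2 * p * b / q\<close>, vanishing at 0.\<close>
    define G where "G b = p / q * (real_of_int b * (b - 1))" for b :: int
    have "(q / 4 - (\<eta> * q + 2))\<^sup>2 \<le> real_of_int (c - w + 1) * (c - w)"
      unfolding power2_eq_square using cw by (intro mult_mono) auto
    moreover have "q\<^sup>2 / 16 - q * (\<eta> * q + 2) / 2 \<le> (q / 4 - (\<eta> * q + 2))\<^sup>2"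
    proof -
      have "q\<^sup>2 / 16 - q * y / 2 \<le> (q / 4 - y)\<^sup>2" for y :: real
        by (simp add: power2_eq_square algebra_simps)
      then show ?thesis .
    qed
    ultimately have "p / q * (q\<^sup>2 / 16 - q * (\<eta> * q + 2) / 2) \<le> G (c - w + 1)"
      unfolding G_def using pq by (intro mult_left_mono) auto
    also have "\<dots> = G (c - w + 1) - G 0" by (simp add: G_def)
    also have "\<dots> \<le> (\<Sum>b\<in>{0..<c - w + 1}. 2 * p * b / q)"
      using cw(4) by (intro sum_int_telescope_le) (auto simp: G_def add_divide_distrib diff_divide_distrib algebra_simps)
    also have "\<dots> \<le> (\<Sum>b\<in>{0..<c - w + 1}. card (A b))"
      unfolding of_nat_sum A_def using pq c assms(5) by (intro sum_mono card_lower_fibre) auto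
    also have "\<dots> = card ?X" using fin by (subst card_SigmaI) auto
    finally have "p / q * (q\<^sup>2 / 16 - q * (\<eta> * q + 2) / 2) \<le> card ?X" .
    moreover have "p / q * (q\<^sup>2 / 16 - q * (\<eta> * q + 2) / 2) = p * (q / 16 - (\<eta> * q + 2) / 2)"
      using pq by (simp add: power2_eq_square field_simps)
    ultimately show ?thesis by simp
  qed
  have Y: "p * (7 * q / 32 - (\<eta> * q + 1) / 2) - q \<le> card ?Y"
  proof -
    define u where "u b = max 0 (real_of_int b - q / 2)" for b :: int
    \<comment> \<open>The continuous antiderivative of the fibre bound. Its increments are at most
      that bound since the square of \<open>u\<close> grows by at least \<open>2 * u b\<close> in
      one step.\<close>
    define G where "G b = p * (b / 2 - (u b)\<^sup>2 / (2 * q)) - b" for b :: int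
    have G: "G (b + 1) - G b \<le> p * (1 / 2 - u b / q) - 1" for b
    proof -
      have "2 * u b \<le> (u (b + 1))\<^sup>2 - (u b)\<^sup>2"
        by (cases "q / 2 \<le> b") (auto simp: u_def power2_eq_square algebra_simps)
      then have "p * (2 * u b) / (2 * q) \<le> p * ((u (b + 1))\<^sup>2 - (u b)\<^sup>2) / (2 * q)"
        using pq by (intro divide_right_mono mult_left_mono) auto
      then have "p * u b / q \<le> p * (u (b + 1))\<^sup>2 / (2 * q) - p * (u b)\<^sup>2 / (2 * q)"
        by (simp add: diff_divide_distrib right_diff_distrib)
      moreover have "G (b + 1) - G b = p / 2 - (p * (u (b + 1))\<^sup>2 / (2 * q) - p * (u b)\<^sup>2 / (2 * q)) - 1"
        by (simp add: G_def right_diff_distrib distrib_left add_divide_distrib)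
      moreover have "p * (1 / 2 - u b / q) = p / 2 - p * u b / q" by (simp add: right_diff_distrib)
      ultimately show ?thesis by linarith
    qed
    have "p * (7 * q / 32 - (\<eta> * q + 1) / 2) - q \<le> G e - G (c + w)"
    proof -
      have "u (c + w) = 0" using cw by (simp add: u_def)
      then have 1: "G (c + w) \<le> p * ((q / 4 + \<eta> * q + 1) / 2) - (c + w)"
        using cw(3) pq by (simp add: G_def)
      define d where "d = e - 3 * real_of_int q / 4"
      have d: "0 \<le> d" "d \<le> q / 4" using e' by (simp_all add: d_def)
      have ue: "u e = q / 4 + d" using d pq by (simp add: u_def d_def)
      have "d * d \<le> d * (q / 4)" using d by (intro mult_left_mono)
      define y where "y = (u e)\<^sup>2 / (2 * q)"
      have "y \<le> q / 32 + d / 4 + d / 8"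
        unfolding ue y_def using pq \<open>d * d \<le> d * (q / 4)\<close> by (simp add: power2_eq_square field_simps)
      moreover have "e / 2 = d / 2 + 3 * real_of_int q / 8" by (simp add: d_def field_simps)
      ultimately have "11 * real_of_int q / 32 \<le> e / 2 - y" using d by linarith
      then have "11 * q / 32 \<le> e / 2 - (u e)\<^sup>2 / (2 * q)" by (simp add: y_def)
      then have "p * (11 * q / 32) \<le> p * (e / 2 - (u e)\<^sup>2 / (2 * q))" using pq by (intro mult_left_mono) auto
      then have 2: "p * (11 * q / 32) - e \<le> G e" unfolding G_def by simp
      have 3: "real_of_int e - (c + w) \<le> q" using e' c assms(5) pq by linarith
      have 4: "p * ((q / 4 + \<eta> * q + 1) / 2) = real_of_int p * real_of_int q / 8 + p * (\<eta> * q) / 2 + p / 2"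
        and 5: "p * (11 * q / 32) = 11 * (real_of_int p * real_of_int q) / 32"
        and 6: "p * (7 * q / 32 - (\<eta> * q + 1) / 2)
          = 7 * (real_of_int p * real_of_int q) / 32 - p * (\<eta> * q) / 2 - p / 2"
        by (simp_all add: field_simps)
      \<comment> \<open>Products such as \<open>p * q\<close> are replaced by variables, which
        leaves a purely linear inequality.\<close>
      have "z - y \<le> g2 - g1"
        if "g1 \<le> x - C" "x' - E \<le> g2" "E - C \<le> y" "x = PQ / 8 + M / 2 + P / 2"
          "x' = 11 * PQ / 32" "z = 7 * PQ / 32 - M / 2 - P / 2"
        for g1 g2 x x' y z C E PQ M P :: real
        using that by linarith
      from this[OF 1 2 3 4 5 6] show ?thesis .
    qed
    also have "\<dots> \<le> (\<Sum>b\<in>{c + w..<e}. p * (1 / 2 - u b / q) - 1)"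
      using cw(5) G by (intro sum_int_telescope_le)
    also have "\<dots> \<le> (\<Sum>b\<in>{c + w..<e}. card (A' b))"
      unfolding of_nat_sum A'_def u_def using pq by (intro sum_mono card_upper_fibre) auto
    also have "\<dots> = card ?Y" using fin by (subst card_SigmaI) auto
    finally show ?thesis .
  qed
  \<comment> \<open>The unions of fibres are indexed by \<open>b\<close> first, whereas
    \<open>planar_set\<close> lists \<open>a\<close> first.\<close>
  have sub: "prod.swap ` (?X \<union> ?Y) \<subseteq> planar_set p q w"
    using e by (auto simp: planar_set_def A_def A'_def c_def)
  have "finite (planar_set p q w)"
    by (rule finite_subset[of _ "{0..<p} \<times> {0..<q}"]) (use pq assms(5) in \<open>auto simp: planar_set_def\<close>)
  then have "card (prod.swap ` (?X \<union> ?Y)) \<le> card (planar_set p q w)" using sub by (rule card_mono)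
  moreover have "card (prod.swap ` (?X \<union> ?Y)) = card ?X + card ?Y"
  proof -
    have "card (?X \<union> ?Y) = card ?X + card ?Y"
      by (rule card_Un_disjoint) (use fin assms(5) in \<open>auto intro: finite_SigmaI\<close>)
    then show ?thesis by (simp only: card_image[OF inj_swap])
  qed
  ultimately have card: "real (card ?X) + card ?Y \<le> card (planar_set p q w)" by linarith
  have "p * 3 / 2 + q \<le> \<eta> * p * q"
  proof -
    have "3 * real_of_int p \<le> (\<eta> * q) * p" using \<eta>pq pq by (intro mult_right_mono) auto
    moreover have "3 * real_of_int q \<le> (\<eta> * p) * q" using \<eta>pq pq by (intro mult_right_mono) auto
    moreover have "(\<eta> * q) * p = \<eta> * p * q" by simp
    moreover have "0 < real_of_int q" using pq by simp
    ultimately show ?thesis unfolding of_int_mult of_int_numeral by linarith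
  qed
  then have "(9 / 32 - 2 * \<eta>) * (p * q) \<le> p * (q / 16 - (\<eta> * q + 2) / 2) + (p * (7 * q / 32 - (\<eta> * q + 1) / 2) - q)"
    by (simp add: field_simps)
  then show ?thesis using X Y card by linarith
qed

text \<open>\<open>l\<close> is the least integer satisfying the strict inequality needed for
  convexity. As \<open>w\<close> is at least \<open>\<eta> * q\<close>, it has order
  \<open>T\<^sup>2 / (\<eta> * q)\<close>; the hinge is at most \<open>q / 4\<close>, so the factor
  \<open>q\<close> cancels and the height keeps the order of \<open>T\<^sup>2\<close>.\<close>

lemma height_bounds:
  fixes p q w :: int and \<eta> T :: real
  assumes "0 < \<eta>" "0 < p" "0 < q" "p \<le> T" "q \<le> T" "1 \<le> T" "\<eta> * q \<le> w" "0 < w"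
  defines "l \<equiv> \<lfloor>2 * (p\<^sup>2 + q\<^sup>2) / real_of_int w\<rfloor> + 1"
  shows "0 \<le> l" "2 * (p\<^sup>2 + q\<^sup>2) < l * w"
    "s \<in> planar_set p q w \<Longrightarrow> 0 \<le> height q l s \<and> height q l s \<le> (3 + 1 / \<eta>) * T\<^sup>2"
proof -
  define x where "x = 2 * (p\<^sup>2 + q\<^sup>2) / real_of_int w"
  have x0: "0 \<le> x" using assms by (simp add: x_def)
  then show l0: "0 \<le> l" unfolding l_def x_def[symmetric] by linarith
  have "x < l" unfolding l_def x_def[symmetric] by linarith
  then have "x * w < real_of_int l * w" using assms by (intro mult_strict_right_mono) auto
  moreover have "x * w = real_of_int (2 * (p\<^sup>2 + q\<^sup>2))" using assms by (simp add: x_def)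
  ultimately have "real_of_int (2 * (p\<^sup>2 + q\<^sup>2)) < real_of_int (l * w)" by simp
  then show "2 * (p\<^sup>2 + q\<^sup>2) < l * w" by (simp only: of_int_less_iff)
  assume s: "s \<in> planar_set p q w"
  obtain a b where ab: "s = (a, b)" by (cases s)
  have rng: "0 \<le> a" "a \<le> p" "0 \<le> b" "b \<le> q" using s ab assms(3,8) by (auto simp: planar_set_def)
  have sq: "(real_of_int y)\<^sup>2 \<le> T\<^sup>2" if "0 \<le> y" "y \<le> T" for y :: int
    using that by (intro power_mono) auto
  have "x \<le> 4 * T\<^sup>2 / (\<eta> * q)"
  proof -
    have "(real_of_int p)\<^sup>2 \<le> T\<^sup>2" "(real_of_int q)\<^sup>2 \<le> T\<^sup>2" using sq assms(2-5) by auto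
    then have "real_of_int (2 * (p\<^sup>2 + q\<^sup>2)) \<le> 4 * T\<^sup>2" by simp
    then show ?thesis unfolding x_def using assms(1-3,7) by (intro frac_le) auto
  qed
  then have "x * q \<le> 4 * T\<^sup>2 / (\<eta> * q) * q" using assms(3) by (intro mult_right_mono) auto
  then have xq: "x * q \<le> 4 * (T\<^sup>2 / \<eta>)" using assms(1,3) by simp
  have "real_of_int l \<le> x + 1" unfolding l_def x_def[symmetric] by linarith
  then have "real_of_int l * q \<le> (x + 1) * q" using assms(3) by (intro mult_right_mono) auto
  then have lq: "real_of_int l * q \<le> 4 * (T\<^sup>2 / \<eta>) + T" using xq assms(5) by (simp add: algebra_simps)
  have "real_of_int (max 0 (q div 4 - b)) \<le> q / 4" using rng assms(3) by linarith
  then have "l * real_of_int (max 0 (q div 4 - b)) \<le> l * (q / 4)" using l0 by (intro mult_left_mono) auto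
  then have "l * real_of_int (max 0 (q div 4 - b)) \<le> T\<^sup>2 / \<eta> + T / 4" using lq by simp
  moreover have "T \<le> T\<^sup>2" using assms(6) by (simp add: power2_eq_square)
  moreover have "(real_of_int a)\<^sup>2 \<le> T\<^sup>2" "(real_of_int b)\<^sup>2 \<le> T\<^sup>2" using sq rng assms(4,5) by auto
  ultimately have "real_of_int (height q l s) \<le> (3 + 1 / \<eta>) * T\<^sup>2"
    using assms(6) by (simp add: height_def ab algebra_simps)
  moreover have "0 \<le> height q l s" using l0 by (simp add: height_def ab)
  ultimately show "0 \<le> height q l s \<and> height q l s \<le> (3 + 1 / \<eta>) * T\<^sup>2" by simp
qed

lemma planar_block:
  fixes p q :: int and \<eta> T :: real
  assumes "0 < \<eta>" "\<eta> \<le> 1 / 16" "3 / \<eta> \<le> p" "3 / \<eta> \<le> q" "p \<le> T" "q \<le> T" "odd p" "coprime p q"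
  shows "\<exists>U F. midpoint_convex_mod (p * q) U F \<and> (9 / 32 - 2 * \<eta>) * (p * q) \<le> card U
    \<and> (\<forall>n\<in>U. 0 \<le> F n \<and> F n \<le> (3 + 1 / \<eta>) * T\<^sup>2)"
proof -
  have "48 \<le> 3 / \<eta>" using assms(1,2) by (simp add: field_simps)
  then have pos: "0 < p" "0 < q" "1 \<le> T" using assms(3-5) by linarith+
  \<comment> \<open>A strip width proportional to \<open>q\<close> costs only density of order
    \<open>\<eta>\<close> and costs the height only a constant depending on
    \<open>\<eta>\<close>.\<close>
  define w where "w = \<lfloor>\<eta> * q\<rfloor> + 1"
  have "0 \<le> \<eta> * q" using assms(1) pos by simp
  then have w: "0 < w" "w \<le> \<eta> * q + 1" "\<eta> * q \<le> w" unfolding w_def by linarith+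
  define l where "l = \<lfloor>2 * (p\<^sup>2 + q\<^sup>2) / real_of_int w\<rfloor> + 1"
  note h = height_bounds[OF assms(1) pos(1,2) assms(5,6) pos(3) w(3,1), folded l_def]
  note U = midpoint_convex_mod_planar[OF assms(7,8) pos(1,2) w(1) h(1,2)]
  show ?thesis
    using U(1) card_planar_set_ge[OF assms(1-4) w(1,2)] U(2) h(3)
    by (intro exI[of _ "{n \<in> {0..<p * q}. (n mod p, n mod q) \<in> planar_set p q w}"]
        exI[of _ "\<lambda>n. height q l (n mod p, n mod q)"]) auto
qed

subsection \<open>A lower bound for the number of primes\<close>

text \<open>The recurrence of Leibniz's harmonic triangle: each entry is the sum of the two entries
  below it.\<close>

lemma Leibniz_triangle:
  assumes "1 \<le> k" "k < n"
  shows "1 / (real k * real (n - 1 choose k)) =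
    1 / (real k * real (n choose k)) + 1 / (real (Suc k) * real (n choose Suc k))"
proof -
  obtain r where n: "n = Suc r" using assms by (cases n) auto
  have "Suc k * (Suc r choose Suc k) = Suc r * (r choose k)"
    by (metis Suc_times_binomial_eq mult.commute)
  then have 1: "real (Suc k) * real (n choose Suc k) = real n * real (r choose k)"
    unfolding n by (metis of_nat_mult)
  have "(Suc r choose k) * (Suc r - k) = Suc r * (r choose k)"
    using binomial_absorb_comp[of "Suc r" k] by (simp add: mult.commute)
  then have "real (n choose k) * real (n - k) = real n * real (r choose k)"
    unfolding n by (metis of_nat_mult)
  then have 2: "real (n choose k) = real n * real (r choose k) / real (n - k)"
    using assms by (simp add: field_simps)
  have r: "n - 1 = r" by (simp add: n)
  have pos: "0 < real (r choose k)" "0 < real n" "0 < real k" "0 < real (n - k)" "real (n - k) = real n - real k"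
    using assms n by auto
  show ?thesis unfolding 1 2 r using pos by (simp add: field_simps)
qed

text \<open>The reciprocals of \<open>k * (n choose k)\<close> form the harmonic triangle. Its first
  column is \<open>1 / n\<close>, and every further entry is a difference of an entry in the
  previous row and one to its left, so multiplication by the least common multiple makes all of them
  integers.\<close>

lemma mult_binomial_dvd_Lcm:
  assumes "1 \<le> k" "k \<le> n"
  shows "k * (n choose k) dvd Lcm {1..n}"
proof -
  have "\<exists>i::int. real (Lcm {1..n}) / (real k * real (n choose k)) = of_int i"
    using assms
  proof (induction n arbitrary: k)
    case (Suc n)
    note outer = Suc.IH
    from Suc.prems show ?case
    proof (induction k rule: nat_induct_at_least)
      case base
      have "Suc n dvd Lcm {1..Suc n}" by (intro dvd_Lcm) auto
      then obtain i where "Lcm {1..Suc n} = Suc n * i" by blast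
      then have "real (Lcm {1..Suc n}) / (real 1 * real (Suc n choose 1)) = of_int (int i)" by (simp add: field_simps)
      then show ?case by blast
    next
      case (Suc k)
      have "Lcm {1..n} dvd Lcm {1..Suc n}" by (intro Lcm_subset) auto
      then obtain t where t: "Lcm {1..Suc n} = Lcm {1..n} * t" by blast
      have tr: "real (Lcm {1..Suc n}) = real (Lcm {1..n}) * real t" unfolding t by simp
      obtain i where i: "real (Lcm {1..n}) / (real k * real (n choose k)) = of_int i"
        using outer[of k] Suc by auto
      obtain j where j: "real (Lcm {1..Suc n}) / (real k * real (Suc n choose k)) = of_int j"
        using Suc by auto
      have "1 / (real (Suc k) * real (Suc n choose Suc k)) =
        1 / (real k * real (n choose k)) - 1 / (real k * real (Suc n choose k))"
        using Leibniz_triangle[of k "Suc n"] Suc by simp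
      then have "real (Lcm {1..Suc n}) * (1 / (real (Suc k) * real (Suc n choose Suc k))) =
        real (Lcm {1..Suc n}) * (1 / (real k * real (n choose k)) - 1 / (real k * real (Suc n choose k)))"
        by (rule arg_cong)
      also have "\<dots> = real t * (real (Lcm {1..n}) / (real k * real (n choose k)))
          - real (Lcm {1..Suc n}) / (real k * real (Suc n choose k))"
        unfolding right_diff_distrib tr by simp
      also have "\<dots> = of_int (int t * i - j)" unfolding i j by simp
      finally show ?case by (intro exI[of _ "int t * i - j"]) simp
    qed
  qed auto
  then obtain i :: int where "real (Lcm {1..n}) / (real k * real (n choose k)) = of_int i" by blast
  moreover have "0 < real k * real (n choose k)" using assms by simp
  ultimately have "real (Lcm {1..n}) = of_int i * (real k * real (n choose k))"
    by (simp only: divide_eq_eq less_imp_neq[symmetric] if_False mult.commute) (simp add: mult.commute)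
  then have "real_of_int (int (Lcm {1..n})) = real_of_int (i * int (k * (n choose k)))" by simp
  then have "int (Lcm {1..n}) = i * int (k * (n choose k))" by (simp only: of_int_eq_iff)
  then have "int (k * (n choose k)) dvd int (Lcm {1..n})" by simp
  then show ?thesis by (simp only: int_dvd_int_iff)
qed

lemma Lcm_atLeast_1_pos: "0 < Lcm {1..n::nat}"
proof -
  have "Lcm {1..n} \<noteq> 0" by simp
  then show ?thesis by (rule neq0_conv[THEN iffD1])
qed

text \<open>Every prime power occurring exactly in the least common multiple already divides some
  \<open>i \<le> n\<close>, hence is at most \<open>n\<close>, and each prime contributes one such
  factor.\<close>

lemma Lcm_atMost_le:
  fixes n :: nat
  assumes "1 \<le> n"
  shows "Lcm {1..n} \<le> n ^ card {p. prime p \<and> p \<le> n}"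
proof -
  define L where "L = Lcm {1..n}"
  let ?P = "{p. prime p \<and> p \<le> n}"
  have L0: "L \<noteq> 0" by (simp add: L_def)
  have dvd_L: "i dvd L" if "i \<in> {1..n}" for i using that unfolding L_def by (rule dvd_Lcm)
  have L_least: "L dvd r" if "\<And>i. i \<in> {1..n} \<Longrightarrow> i dvd r" for r
    using that unfolding L_def by (rule Lcm_least)
  have fin: "finite ?P" by simp
  have pw: "p \<in> ?P \<and> p ^ multiplicity p L \<le> n" if p: "p \<in> prime_factors L" for p
  proof -
    have pr: "prime p" using p by auto
    define e where "e = multiplicity p L"
    have "1 \<le> e" unfolding e_def using p by (simp add: prime_factors_multiplicity)
    have "\<exists>i\<in>{1..n}. p ^ e dvd i"
    proof (rule ccontr)
      assume "\<not> (\<exists>i\<in>{1..n}. p ^ e dvd i)"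
      then have small: "multiplicity p i < e" if "i \<in> {1..n}" for i
        using that multiplicity_dvd'[of e p i] by (meson not_less)
      \<comment> \<open>If no \<open>i\<close> were divisible by \<open>p ^ e\<close>, one factor
        \<open>p\<close> could be cancelled and \<open>r\<close> would be a smaller common
        multiple.\<close>
      define r where "r = L div p"
      have "p dvd L" using p by auto
      then have r: "L = p * r" by (simp add: r_def)
      then have r0: "0 < r" using L0 by (metis mult_0_right neq0_conv)
      have "i dvd r" if i: "i \<in> {1..n}" for i
      proof (rule multiplicity_le_imp_dvd)
        show "i \<noteq> 0" using i by auto
        fix s :: nat assume s: "prime s"
        show "multiplicity s i \<le> multiplicity s r"
        proof (cases "s = p")
          case True
          have "e = Suc (multiplicity p r)"
            unfolding e_def r using pr r0 by (subst multiplicity_times_same) auto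
          then show ?thesis using small[OF i] True by simp
        next
          case False
          have "\<not> s dvd p" using False s pr primes_dvd_imp_eq by blast
          then have s0: "multiplicity s p = 0" by (rule not_dvd_imp_multiplicity_0)
          have "multiplicity s (p * r) = multiplicity s p + multiplicity s r"
            using s pr r0 by (intro prime_elem_multiplicity_mult_distrib) auto
          moreover have "multiplicity s i \<le> multiplicity s L"
            using i L0 by (intro dvd_imp_multiplicity_le dvd_L)
          ultimately show ?thesis using s0 unfolding r by linarith
        qed
      qed
      then have "L dvd r" by (rule L_least)
      then have "L \<le> r" using r0 by (rule dvd_imp_le)
      moreover have "1 * r < p * r" using prime_gt_1_nat[OF pr] r0 by (intro mult_strict_right_mono)
      then have "r < L" using r by simp
      ultimately show False by simp
    qed
    then obtain i where i: "i \<in> {1..n}" "p ^ e dvd i" by blast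
    then have "p ^ e \<le> n" using dvd_imp_le[of "p ^ e" i] by simp
    moreover have "p \<le> p ^ e" using \<open>1 \<le> e\<close> prime_gt_1_nat[OF pr] by (simp add: self_le_power)
    ultimately show ?thesis using pr by (simp add: e_def)
  qed
  have "L = (\<Prod>p\<in>prime_factors L. p ^ multiplicity p L)"
    using L0 by (intro prime_factorization_nat) simp
  also have "\<dots> \<le> (\<Prod>p\<in>prime_factors L. n)" using pw by (intro prod_mono conjI) auto
  also have "\<dots> = n ^ card (prime_factors L)" by simp
  also have "\<dots> \<le> n ^ card ?P"
    using assms fin pw by (intro power_increasing card_mono) auto
  finally show ?thesis unfolding L_def .
qed

text \<open>Any bound on the \<open>m\<close>-th prime that is subexponential in \<open>m\<close> would suffice for the theorem.\<close>

lemma card_primes_ge: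
  assumes "1 \<le> m"
  shows "4 * m \<le> card {p::nat. prime p \<and> p \<le> 64 * m\<^sup>2}"
proof -
  \<comment> \<open>The estimates below give \<open>2 ^ n \<le> (2 * n) ^ c\<close> with
    \<open>2 * n \<le> 2 ^ (6 + 2 * m)\<close>, hence \<open>n \<le> 8 * m * c\<close>; the factor
    32 makes this \<open>4 * m \<le> c\<close>.\<close>
  define n where "n = 32 * m\<^sup>2"
  define c where "c = card {p::nat. prime p \<and> p \<le> 2 * n}"
  have n: "1 \<le> n" using assms by (simp add: n_def)
  have "4 ^ n / (2 * real n) \<le> real (2 * n choose n)" using n by (intro central_binomial_lower_bound) simp
  then have "real (4 ^ n) \<le> real (2 * (n * (2 * n choose n)))" using n by (simp add: field_simps)
  then have "4 ^ n \<le> 2 * (n * (2 * n choose n))" by (simp only: of_nat_le_iff)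
  moreover have "2 * 2 ^ n \<le> (2::nat) ^ n * 2 ^ n" using n by (intro mult_right_mono self_le_power) auto
  then have "2 * 2 ^ n \<le> (4::nat) ^ n" by (simp flip: power_mult_distrib)
  ultimately have two: "2 ^ n \<le> n * (2 * n choose n)" by linarith
  have "n * (2 * n choose n) dvd Lcm {1..2 * n}" using n by (intro mult_binomial_dvd_Lcm) auto
  then have "n * (2 * n choose n) \<le> Lcm {1..2 * n}" using Lcm_atLeast_1_pos by (rule dvd_imp_le)
  moreover have "Lcm {1..2 * n} \<le> (2 * n) ^ c" unfolding c_def using n by (intro Lcm_atMost_le) auto
  ultimately have "(2::nat) ^ n \<le> (2 * n) ^ c" using two by linarith
  also have "2 * n \<le> 2 ^ (6 + 2 * m)"
  proof -
    have "m\<^sup>2 \<le> (2 ^ m)\<^sup>2" by (intro power_mono) (auto intro: less_imp_le)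
    moreover have "(2::nat) ^ (6 + 2 * m) = 64 * (2 ^ m)\<^sup>2" by (simp add: power_add power_even_eq)
    ultimately show ?thesis by (simp add: n_def)
  qed
  then have "(2 * n) ^ c \<le> (2 ^ (6 + 2 * m)) ^ c" by (intro power_mono) auto
  finally have "(2::nat) ^ n \<le> 2 ^ ((6 + 2 * m) * c)" by (simp only: power_mult)
  then have "n \<le> (6 + 2 * m) * c" by simp
  also have "\<dots> \<le> (8 * m) * c" using assms by (intro mult_right_mono) auto
  finally have "8 * m * (4 * m) \<le> 8 * m * c" by (simp add: n_def power2_eq_square)
  then have "4 * m \<le> c" using assms by simp
  then show ?thesis by (simp add: c_def n_def)
qed

subsection \<open>Balanced prime powers\<close>

text \<open>Extremal choice: among balanced exponents with product at most \<open>N\<close>, take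
  the largest product. Multiplying the smallest prime power by its prime keeps balance, so the new
  product must exceed \<open>N\<close>, and it is at most \<open>B\<close> times the old
  one.\<close>

lemma balanced_prime_powers:
  fixes P :: "nat set" and B N :: nat
  assumes "finite P" "P \<noteq> {}" and P: "\<And>p. p \<in> P \<Longrightarrow> prime p \<and> p \<le> B" and "1 \<le> N"
  obtains k :: "nat \<Rightarrow> nat" where "\<And>p p'. p \<in> P \<Longrightarrow> p' \<in> P \<Longrightarrow> p ^ k p \<le> B * p' ^ k p'"
    and "(\<Prod>p\<in>P. p ^ k p) \<le> N" and "N < B * (\<Prod>p\<in>P. p ^ k p)"
proof -
  define bal where "bal k \<longleftrightarrow> (\<forall>p\<in>P. \<forall>p'\<in>P. p ^ k p \<le> B * p' ^ k p')" for k :: "nat \<Rightarrow> nat"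
  define Q where "Q k = (\<Prod>p\<in>P. p ^ k p)" for k :: "nat \<Rightarrow> nat"
  \<comment> \<open>The maximum is taken over the products, a finite set; the exponent functions
    themselves are unrestricted outside \<open>P\<close>.\<close>
  define V where "V = Q ` {k. bal k \<and> Q k \<le> N}"
  have "1 \<le> B" using assms(2) P prime_ge_1_nat le_trans by blast
  then have "bal (\<lambda>_. 0)" "Q (\<lambda>_. 0) \<le> N" using assms(4) by (auto simp: bal_def Q_def)
  then have "V \<noteq> {}" unfolding V_def by blast
  have "V \<subseteq> {..N}" unfolding V_def by auto
  then have "finite V" using finite_subset by blast
  then have "Max V \<in> V" using \<open>V \<noteq> {}\<close> by (rule Max_in)
  then obtain k where k: "bal k" "Q k \<le> N" "Q k = Max V" unfolding V_def by auto
  \<comment> \<open>Raising the exponent of the smallest prime power keeps the family balanced.\<close>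
  define p0 where "p0 = arg_min_on (\<lambda>p. p ^ k p) P"
  have p0: "p0 \<in> P" unfolding p0_def using assms(1,2) by (rule arg_min_if_finite(1))
  have min: "p0 ^ k p0 \<le> p ^ k p" if "p \<in> P" for p
    using arg_min_least[OF assms(1,2) that] by (simp add: p0_def)
  define k' where "k' = k(p0 := Suc (k p0))"
  have Qk': "Q k' = p0 * Q k"
  proof -
    have "(\<Prod>p\<in>P - {p0}. p ^ k' p) = (\<Prod>p\<in>P - {p0}. p ^ k p)" by (rule prod.cong) (auto simp: k'_def)
    then show ?thesis unfolding Q_def
      using prod.remove[OF assms(1) p0, of "\<lambda>p. p ^ k' p"] prod.remove[OF assms(1) p0, of "\<lambda>p. p ^ k p"]
      by (simp add: k'_def)
  qed
  have mono: "p ^ k p \<le> p ^ k' p" if "p \<in> P" for p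
    using P[OF that] prime_ge_1_nat[of p] by (auto simp: k'_def intro: power_increasing)
  have "bal k'"
    unfolding bal_def
  proof (intro ballI)
    fix p p' assume pp: "p \<in> P" "p' \<in> P"
    have low: "p0 ^ k p0 \<le> p' ^ k' p'" using min[OF pp(2)] mono[OF pp(2)] by linarith
    show "p ^ k' p \<le> B * p' ^ k' p'"
    proof (cases "p = p0")
      case True
      then have "p ^ k' p = p0 * p0 ^ k p0" by (simp add: k'_def)
      also have "\<dots> \<le> B * p' ^ k' p'" using P[OF p0] low by (intro mult_mono) auto
      finally show ?thesis .
    next
      case False
      then have "p ^ k' p \<le> B * p0 ^ k p0" using k(1) pp(1) p0 by (auto simp: bal_def k'_def)
      also have "\<dots> \<le> B * p' ^ k' p'" using low by simp
      finally show ?thesis .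
    qed
  qed
  have "0 < Q k" unfolding Q_def using P prime_gt_0_nat by (intro prod_pos) auto
  have "N < B * Q k"
  proof (rule ccontr)
    assume "\<not> N < B * Q k"
    moreover have "p0 * Q k \<le> B * Q k" using P[OF p0] by simp
    ultimately have "Q k' \<le> N" using Qk' by linarith
    then have "Q k' \<in> V" using \<open>bal k'\<close> unfolding V_def by blast
    then have "Q k' \<le> Q k" using \<open>finite V\<close> k(3) by simp
    moreover have "1 < p0" using P[OF p0] prime_gt_1_nat by blast
    ultimately show False using Qk' \<open>0 < Q k\<close> by simp
  qed
  then show thesis using that[of k] k by (auto simp: bal_def Q_def)
qed

subsection \<open>The lower bound with parameters\<close>

lemma prod_lessThan_double:
  fixes f :: "nat \<Rightarrow> 'a::comm_monoid_mult"
  shows "(\<Prod>i<2 * m. f i) = (\<Prod>j<m. f (2 * j) * f (2 * j + 1))"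
  by (induction m) (simp_all add: mult.assoc)

text \<open>The \<open>2 * m\<close> balanced prime powers are paired into \<open>m\<close> planar
  blocks. Their product is within a factor \<open>B\<close> of \<open>N\<close>, and balance bounds
  the square of each modulus by \<open>B\<^sup>2 * N powr (1 / m)\<close>, which controls the number
  of level sets.\<close>

lemma r3_lower_bound:
  fixes P :: "nat set" and B N m :: nat and \<eta> :: real
  assumes "0 < \<eta>" "\<eta> \<le> 1 / 16" "1 \<le> m" "finite P" "card P = 2 * m"
    and P: "\<And>p. p \<in> P \<Longrightarrow> prime p \<and> odd p \<and> p \<le> B"
    and N: "(3 / \<eta> * B) ^ (2 * m) * B \<le> N"
  shows "(9 / 32 - 2 * \<eta>) ^ m * N \<le> B * (m * ((3 + 1 / \<eta>) * (B\<^sup>2 * N powr (1 / m))) + 1) * r3 N"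
proof -
  have "P \<noteq> {}" using assms(3,5) by auto
  then obtain p1 where "p1 \<in> P" by blast
  then have B: "2 \<le> B" using P[of p1] prime_ge_2_nat[of p1] by linarith
  have "0 < (3 / \<eta> * B) ^ (2 * m) * B" using assms(1) B by simp
  then have N1: "1 \<le> N" using N by linarith
  obtain k where bal: "\<And>p p'. p \<in> P \<Longrightarrow> p' \<in> P \<Longrightarrow> p ^ k p \<le> B * p' ^ k p'"
    and Q: "(\<Prod>p\<in>P. p ^ k p) \<le> N" "N < B * (\<Prod>p\<in>P. p ^ k p)"
    using balanced_prime_powers[OF assms(4) \<open>P \<noteq> {}\<close> _ N1, of B] P by blast
  obtain e where e: "bij_betw e {0..<2 * m} P"
    using ex_bij_betw_nat_finite[OF assms(4)] assms(5) by auto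
  have eP: "e i \<in> P" if "i < 2 * m" for i using e that by (auto simp: bij_betw_def)
  define q where "q i = e i ^ k (e i)" for i
  have prodq: "(\<Prod>i<2 * m. q i) = (\<Prod>p\<in>P. p ^ k p)"
    unfolding q_def using prod.reindex_bij_betw[OF e, of "\<lambda>p. p ^ k p"] by (simp add: lessThan_atLeast0)
  have balq: "q i \<le> B * q j" if "i < 2 * m" "j < 2 * m" for i j
    unfolding q_def using bal eP that by blast
  \<comment> \<open>One modulus below \<open>3 / \<eta>\<close> would by balance keep all of them
    below \<open>3 / \<eta> * B\<close>, making the product too small for the assumed size of
    \<open>N\<close>.\<close>
  have big: "3 / \<eta> \<le> q i" if i: "i < 2 * m" for i
  proof (rule ccontr)
    assume "\<not> 3 / \<eta> \<le> q i"
    then have "real (q j) \<le> 3 / \<eta> * B" if "j < 2 * m" for j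
    proof -
      have "real (q j) \<le> real (B * q i)" using balq[OF that i] by (simp only: of_nat_le_iff)
      also have "\<dots> \<le> B * (3 / \<eta>)" unfolding of_nat_mult using \<open>\<not> 3 / \<eta> \<le> q i\<close> by (intro mult_left_mono) auto
      finally show ?thesis by (simp add: mult.commute)
    qed
    then have "(\<Prod>j<2 * m. real (q j)) \<le> (\<Prod>j<2 * m. 3 / \<eta> * B)" by (intro prod_mono) auto
    then have "real (\<Prod>j<2 * m. q j) * B \<le> (3 / \<eta> * B) ^ (2 * m) * B" by (intro mult_right_mono) auto
    also have "\<dots> \<le> N" by (rule N)
    also have "\<dots> < real (B * (\<Prod>j<2 * m. q j))" unfolding prodq using Q(2) by (simp only: of_nat_less_iff)
    finally show False by (simp add: mult.commute)
  qed
  define \<mu> where "\<mu> = Min (q ` {..<2 * m})"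
  have ne: "q ` {..<2 * m} \<noteq> {}" using assms(3) by (auto simp: lessThan_empty_iff)
  have \<mu>le: "\<mu> \<le> q i" if "i < 2 * m" for i unfolding \<mu>_def using that by (intro Min_le) auto
  have "\<mu> \<in> q ` {..<2 * m}" unfolding \<mu>_def using ne by (intro Min_in) auto
  then have qle: "q i \<le> B * \<mu>" if "i < 2 * m" for i using balq that by auto
  have "\<mu> ^ (2 * m) = (\<Prod>i<2 * m. \<mu>)" by simp
  also have "\<dots> \<le> (\<Prod>i<2 * m. q i)" using \<mu>le by (intro prod_mono) auto
  finally have "\<mu> ^ (2 * m) \<le> N" using Q(1) prodq by simp
  then have "real (\<mu> ^ (2 * m)) \<le> real N" by (simp only: of_nat_le_iff)
  then have "((real \<mu>)\<^sup>2) ^ m \<le> real N" by (simp add: power_mult)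
  then have "(((real \<mu>)\<^sup>2) ^ m) powr (1 / m) \<le> real N powr (1 / m)" by (intro powr_mono2) auto
  moreover have "(((real \<mu>)\<^sup>2) ^ m) powr (1 / m) = (real \<mu>)\<^sup>2"
  proof (cases "\<mu> = 0")
    case False
    then have "((real \<mu>)\<^sup>2) ^ m = ((real \<mu>)\<^sup>2) powr m" by (simp add: powr_realpow)
    then show ?thesis using False assms(3) by (simp add: powr_powr)
  qed (use assms(3) in simp)
  ultimately have \<mu>N: "(real \<mu>)\<^sup>2 \<le> N powr (1 / m)" by simp
  define T where "T = real (B * \<mu>)"
  define M where "M j = int (q (2 * j)) * int (q (2 * j + 1))" for j
  define R where "R = (3 + 1 / \<eta>) * T\<^sup>2"
  have cop: "coprime (int (q i)) (int (q j))" if "i < 2 * m" "j < 2 * m" "i \<noteq> j" for i j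
  proof -
    have "e i \<noteq> e j" using inj_onD[OF bij_betw_imp_inj_on[OF e], of i j] that by auto
    then have "coprime (e i) (e j)" using P[OF eP[OF that(1)]] P[OF eP[OF that(2)]] by (intro primes_coprime) auto
    then show ?thesis by (simp add: q_def)
  qed
  have qpos: "0 < q i" if "i < 2 * m" for i
    using P[OF eP[OF that]] prime_gt_0_nat by (simp add: q_def)
  have \<kappa>: "0 \<le> 9 / 32 - 2 * \<eta>" using assms(2) by simp
  have "\<exists>U F. midpoint_convex_mod (\<Prod>j<m. M j) U F \<and> (9 / 32 - 2 * \<eta>) ^ m * (\<Prod>j<m. M j) \<le> card U
    \<and> (\<forall>n\<in>U. 0 \<le> F n \<and> F n \<le> m * R)"
  proof (rule midpoint_convex_mod_prod)
    fix j assume j: "j < m"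
    have oddq: "odd (int (q (2 * j)))" using P[OF eP[of "2 * j"]] j by (simp add: q_def)
    show "\<exists>U F. midpoint_convex_mod (M j) U F \<and> (9 / 32 - 2 * \<eta>) * M j \<le> card U \<and> (\<forall>n\<in>U. 0 \<le> F n \<and> F n \<le> R)"
      unfolding M_def R_def
    proof (rule planar_block[OF assms(1,2)])
      show "3 / \<eta> \<le> int (q (2 * j))" "3 / \<eta> \<le> int (q (2 * j + 1))" using big j by auto
      show "int (q (2 * j)) \<le> T" "int (q (2 * j + 1)) \<le> T"
        unfolding T_def of_int_of_nat_eq of_nat_le_iff using qle j by auto
      show "coprime (int (q (2 * j))) (int (q (2 * j + 1)))" using j by (intro cop) auto
    qed (fact oddq)
    show "0 < M j" unfolding M_def using qpos j by simp
  next
    fix i j assume "j < m" "i < j"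
    then show "coprime (M i) (M j)" unfolding M_def
      using cop[of "2 * i" "2 * j"] cop[of "2 * i" "2 * j + 1"] cop[of "2 * i + 1" "2 * j"] cop[of "2 * i + 1" "2 * j + 1"]
      by auto
  qed (fact \<kappa>)
  then obtain U F where U: "midpoint_convex_mod (\<Prod>j<m. M j) U F"
    "(9 / 32 - 2 * \<eta>) ^ m * (\<Prod>j<m. M j) \<le> card U" "\<forall>n\<in>U. 0 \<le> F n \<and> F n \<le> m * R"
    by blast
  have prodM: "(\<Prod>j<m. M j) = int (\<Prod>i<2 * m. q i)"
    unfolding prod_lessThan_double M_def by simp
  have R0: "0 \<le> R" unfolding R_def using assms(1) by simp
  have QN: "(\<Prod>j<m. M j) \<le> int N" unfolding prodM prodq using Q(1) by (simp only: of_nat_le_iff)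
  have "card U \<le> (m * R + 1) * r3 N"
    by (rule r3_ge_of_midpoint_convex_mod[OF U(1) _ _ QN]) (use U(3) R0 in auto)
  then have 1: "(9 / 32 - 2 * \<eta>) ^ m * real (\<Prod>i<2 * m. q i) \<le> (m * R + 1) * r3 N"
    using U(2) prodM by simp
  have "real N \<le> real (B * (\<Prod>i<2 * m. q i))" unfolding prodq using Q(2) by (simp only: of_nat_le_iff)
  then have "(9 / 32 - 2 * \<eta>) ^ m * N \<le> (9 / 32 - 2 * \<eta>) ^ m * real (B * (\<Prod>i<2 * m. q i))"
    using \<kappa> by (intro mult_left_mono) auto
  also have "\<dots> = B * ((9 / 32 - 2 * \<eta>) ^ m * real (\<Prod>i<2 * m. q i))" by simp
  also have "\<dots> \<le> B * ((m * R + 1) * r3 N)" using 1 by (intro mult_left_mono) auto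
  also have "\<dots> \<le> B * ((m * ((3 + 1 / \<eta>) * (B\<^sup>2 * N powr (1 / m))) + 1) * r3 N)"
  proof -
    have "T\<^sup>2 \<le> B\<^sup>2 * N powr (1 / m)" unfolding T_def using \<mu>N by (simp add: power_mult_distrib mult_left_mono)
    then have "R \<le> (3 + 1 / \<eta>) * (B\<^sup>2 * N powr (1 / m))" unfolding R_def using assms(1) by (intro mult_left_mono) auto
    then show ?thesis by (intro mult_left_mono mult_right_mono add_right_mono) auto
  qed
  finally show ?thesis by (simp add: mult.assoc)
qed

lemma odd_primes_subset:
  assumes "1 \<le> m"
  obtains P :: "nat set" where "finite P" "card P = 2 * m" "\<And>p. p \<in> P \<Longrightarrow> prime p \<and> odd p \<and> p \<le> 64 * m\<^sup>2"
proof -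
  let ?A = "{p::nat. prime p \<and> p \<le> 64 * m\<^sup>2}"
  have "card ?A - 1 \<le> card (?A - {2})" by (simp add: card_Diff_singleton_if)
  then have "2 * m \<le> card (?A - {2})" using card_primes_ge[OF assms] assms by linarith
  then obtain P where P: "P \<subseteq> ?A - {2}" "card P = 2 * m" "finite P" by (rule obtain_subset_with_card_n)
  moreover have "prime p \<and> odd p \<and> p \<le> 64 * m\<^sup>2" if "p \<in> P" for p
    using that P(1) primes_dvd_imp_eq[of 2 p] two_is_prime_nat by auto
  ultimately show thesis using that by blast
qed

subsection \<open>Asymptotics\<close>

lemma r3_pos:
  assumes "1 \<le> N"
  shows "1 \<le> r3 N"
  using card_le_r3[of "{1}" N] assms by (auto simp: three_AP_free_def)

text \<open>Write \<open>x = sqrt (log 2 N)\<close> and \<open>s\<^sup>2 = log 2 (32 / 9)\<close>.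
  With \<open>m\<close> blocks the density costs \<open>s\<^sup>2 * m\<close> and the level sets
  cost \<open>x\<^sup>2 / m\<close> in the exponent; \<open>m\<close> near \<open>x / s\<close>
  balances both at \<open>s * x\<close>. The sum \<open>2 * s * x\<close> is the target since
  \<open>c = s / sqrt 2\<close>.\<close>

lemma eventually_r3_ge:
  fixes \<epsilon> :: real
  assumes \<epsilon>: "0 < \<epsilon>"
  defines "c \<equiv> sqrt (log 2 (sqrt (32 / 9)))"
  shows "\<forall>\<^sub>F N in sequentially. N * 2 powr (- (c + \<epsilon>) * (2 * sqrt (2 * log 2 (real N)))) \<le> r3 N"
proof -
  define l where "l = log 2 (32 / 9 :: real)"
  define s where "s = sqrt l"
  have l: "0 < l" by (simp add: l_def)
  then have s: "0 < s" "s * s = l" by (simp_all add: s_def)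
  have "sqrt (32 / 9) = (32 / 9 :: real) powr (1 / 2)" by (rule powr_half_sqrt[symmetric]) simp
  then have "log 2 (sqrt (32 / 9)) = l / 2" unfolding l_def by (simp only: log_powr)
  then have c: "c = s / sqrt 2" unfolding c_def s_def by (simp only: real_sqrt_divide)
  \<comment> \<open>The target leaves slack \<open>2 * sqrt 2 * \<epsilon> * x\<close>. Replacing
    \<open>l\<close> by \<open>l'\<close> spends \<open>\<epsilon> * x\<close> of it to allow a
    positive \<open>\<eta>\<close>; the remaining \<open>a * x\<close> absorbs all factors
    polynomial in \<open>m\<close>.\<close>
  define l' where "l' = l + \<epsilon> * s"
  define \<kappa> where "\<kappa> = 2 powr (- l')"
  have "l < l'" unfolding l'_def using \<epsilon> s by simp
  then have "\<kappa> < 2 powr (- l)" by (simp add: \<kappa>_def)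
  then have \<kappa>: "\<kappa> < 9 / 32" by (simp add: l_def powr_minus)
  define \<eta> where "\<eta> = min (1 / 16) ((9 / 32 - \<kappa>) / 2)"
  have \<eta>: "0 < \<eta>" "\<eta> \<le> 1 / 16" "\<kappa> \<le> 9 / 32 - 2 * \<eta>" using \<kappa> by (auto simp: \<eta>_def min_def field_simps)
  define K where "K = 3 + 1 / \<eta>"
  have K: "3 \<le> K" using \<eta> by (simp add: K_def)
  define a where "a = (2 * sqrt 2 - 1) * \<epsilon>"
  have "1 < sqrt (2::real)" by simp
  then have "0 < 2 * sqrt (2::real) - 1" by linarith
  then have a: "0 < a" using \<epsilon> unfolding a_def by (rule mult_pos_pos)
  have C: "0 < 2 * K * 64 ^ 3" "0 < 3 / \<eta> * 64" using K \<eta> by auto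
  \<comment> \<open>The first condition lets the slack absorb the polynomial factors, the second
    makes \<open>N\<close> large enough for the prime powers. Both use the real bound
    \<open>x / s + 1\<close> in place of the integer \<open>m\<close>.\<close>
  have "\<forall>\<^sub>F x in at_top. l' + log 2 (2 * K * 64 ^ 3 * (x / s + 1) ^ 7) \<le> a * x"
    using C(1) s(1) a by real_asymp
  moreover have "\<forall>\<^sub>F x in at_top. 2 * (x / s + 1) * log 2 (3 / \<eta> * 64 * (x / s + 1)\<^sup>2) + log 2 (64 * (x / s + 1)\<^sup>2) \<le> x\<^sup>2"
    using C(2) s(1) by real_asymp
  moreover have "\<forall>\<^sub>F x::real in at_top. 0 < x" by (rule eventually_gt_at_top)
  ultimately have "\<forall>\<^sub>F x in at_top. l' + log 2 (2 * K * 64 ^ 3 * (x / s + 1) ^ 7) \<le> a * x \<and>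
      2 * (x / s + 1) * log 2 (3 / \<eta> * 64 * (x / s + 1)\<^sup>2) + log 2 (64 * (x / s + 1)\<^sup>2) \<le> x\<^sup>2 \<and> 0 < x"
    by (intro eventually_conj)
  moreover have "filterlim (\<lambda>N::nat. sqrt (log 2 (real N))) at_top sequentially" by real_asymp
  ultimately have "\<forall>\<^sub>F N::nat in sequentially. let x = sqrt (log 2 (real N)) in
      l' + log 2 (2 * K * 64 ^ 3 * (x / s + 1) ^ 7) \<le> a * x \<and>
      2 * (x / s + 1) * log 2 (3 / \<eta> * 64 * (x / s + 1)\<^sup>2) + log 2 (64 * (x / s + 1)\<^sup>2) \<le> x\<^sup>2 \<and> 0 < x"
    unfolding Let_def by (rule eventually_compose_filterlim)
  then show ?thesis
  proof (rule eventually_mono)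
    fix N :: nat
    define x where "x = sqrt (log 2 (real N))"
    define y where "y = x / s + 1"
    define m where "m = nat \<lceil>x / s\<rceil>"
    assume "let x = sqrt (log 2 (real N)) in
      l' + log 2 (2 * K * 64 ^ 3 * (x / s + 1) ^ 7) \<le> a * x \<and>
      2 * (x / s + 1) * log 2 (3 / \<eta> * 64 * (x / s + 1)\<^sup>2) + log 2 (64 * (x / s + 1)\<^sup>2) \<le> x\<^sup>2 \<and> 0 < x"
    then have E1: "l' + log 2 (2 * K * 64 ^ 3 * y ^ 7) \<le> a * x"
      and E2: "2 * y * log 2 (3 / \<eta> * 64 * y\<^sup>2) + log 2 (64 * y\<^sup>2) \<le> x\<^sup>2" and x: "0 < x"
      unfolding Let_def x_def[symmetric] y_def[symmetric] by auto
    have "0 < log 2 (real N)" using x unfolding x_def by simp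
    then have N: "1 < real N" by (cases "N = 0") (auto simp: log_def zero_less_divide_iff)
    have x2: "x\<^sup>2 = log 2 (real N)" unfolding x_def using \<open>0 < log 2 (real N)\<close> by simp
    have Nx: "real N = 2 powr x\<^sup>2" unfolding x2 using N by simp
    have xs: "0 < x / s" using x s by simp
    have m: "x / s \<le> m" "m \<le> y" "1 \<le> m" unfolding m_def y_def using xs by linarith+
    have m': "1 \<le> real m" using m(3) by simp
    define B where "B = 64 * m\<^sup>2"
    obtain P :: "nat set" where P: "finite P" "card P = 2 * m" "\<And>p. p \<in> P \<Longrightarrow> prime p \<and> odd p \<and> p \<le> B"
      using odd_primes_subset[OF m(3)] unfolding B_def by blast
    have m2: "(real m)\<^sup>2 \<le> y\<^sup>2" "1 \<le> (real m)\<^sup>2" using m m' by (auto intro: power_mono)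
    have "(3 / \<eta> * B) ^ (2 * m) * B \<le> N"
    proof -
      define z where "z = 3 / \<eta> * B"
      have "1 \<le> 3 / \<eta> * 64" using \<eta> by (simp add: field_simps)
      then have "1 * 1 \<le> 3 / \<eta> * 64 * (real m)\<^sup>2" using m2 \<eta>(1) by (intro mult_mono) auto
      then have z: "1 \<le> z" by (simp add: z_def B_def mult.assoc)
      have zy: "z \<le> 3 / \<eta> * 64 * y\<^sup>2" using m2 \<eta> by (simp add: z_def B_def field_simps)
      have B1: "0 < real B" "real B \<le> 64 * y\<^sup>2" using m2 m(3) by (auto simp: B_def)
      have "z ^ (2 * m) = z powr real (2 * m)" using z by (intro powr_realpow[symmetric]) simp
      also have "\<dots> = (2 powr log 2 z) powr real (2 * m)" using z by simp
      also have "\<dots> = 2 powr (2 * m * log 2 z)" by (simp only: powr_powr of_nat_mult of_nat_numeral mult.commute)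
      finally have "z ^ (2 * m) * B = 2 powr (2 * m * log 2 z + log 2 B)"
        unfolding powr_add using B1(1) by simp
      also have "\<dots> \<le> 2 powr (2 * y * log 2 (3 / \<eta> * 64 * y\<^sup>2) + log 2 (64 * y\<^sup>2))"
      proof -
        have "2 * m * log 2 z \<le> 2 * y * log 2 (3 / \<eta> * 64 * y\<^sup>2)"
          using m m' z zy by (intro mult_mono) auto
        moreover have "log 2 B \<le> log 2 (64 * y\<^sup>2)" using B1 by (intro log_mono) auto
        ultimately show ?thesis by simp
      qed
      also have "\<dots> \<le> 2 powr x\<^sup>2" using E2 by simp
      finally show ?thesis unfolding z_def Nx .
    qed
    note main = r3_lower_bound[OF \<eta>(1,2) m(3) P this, folded K_def]
    \<comment> \<open>Estimating \<open>W + 1\<close> by \<open>2 * W\<close> below leaves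
      \<open>2 * K * m * B ^ 3\<close> with \<open>B = 64 * m\<^sup>2\<close>, whence the power
      7.\<close>
    define D where "D = 2 * K * 64 ^ 3 * real m ^ 7"
    have D: "0 < D" using K m' by (simp add: D_def)
    have N1: "1 \<le> N powr (1 / m)" using N by (simp add: ge_one_powr_ge_zero)
    have "2 powr (- (l' * m)) * N \<le> (9 / 32 - 2 * \<eta>) ^ m * N"
    proof -
      have "2 powr (- (l' * m)) = \<kappa> ^ m" by (simp add: \<kappa>_def powr_powr powr_realpow[symmetric])
      also have "\<dots> \<le> (9 / 32 - 2 * \<eta>) ^ m" using \<eta>(3) by (intro power_mono) (auto simp: \<kappa>_def)
      finally show ?thesis by (intro mult_right_mono) auto
    qed
    also have "\<dots> \<le> B * (m * (K * (B\<^sup>2 * N powr (1 / m))) + 1) * r3 N" by (rule main)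
    also have "\<dots> \<le> D * N powr (1 / m) * r3 N"
    proof -
      have "1 \<le> B" using m(3) by (simp add: B_def)
      define W where "W = m * (K * (B\<^sup>2 * N powr (1 / m)))"
      have "1 * (1 * (1 * 1)) \<le> W"
        unfolding W_def using \<open>1 \<le> B\<close> m' K N1 by (intro mult_mono) auto
      then have "B * (W + 1) \<le> B * (2 * W)" by (intro mult_left_mono) auto
      also have "\<dots> = D * N powr (1 / m)" by (simp add: W_def D_def B_def power_mult_distrib eval_nat_numeral)
      finally have "B * (W + 1) \<le> D * N powr (1 / m)" .
      then show ?thesis unfolding W_def by (intro mult_right_mono) auto
    qed
    also have "\<dots> \<le> 2 powr (log 2 (2 * K * 64 ^ 3 * y ^ 7) + s * x) * r3 N"
    proof -
      have "D \<le> 2 * K * 64 ^ 3 * y ^ 7" unfolding D_def using m m' K by (intro mult_left_mono power_mono) auto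
      then have "D \<le> 2 powr log 2 (2 * K * 64 ^ 3 * y ^ 7)" using D by simp
      moreover have "N powr (1 / m) \<le> 2 powr (s * x)"
      proof -
        have "x\<^sup>2 / m \<le> s * x" using m(1) s x m' by (simp add: field_simps power2_eq_square)
        then show ?thesis unfolding Nx by (simp add: powr_powr)
      qed
      ultimately show ?thesis unfolding powr_add using D by (intro mult_right_mono mult_mono) auto
    qed
    finally have "2 powr (- (l' * m)) * N \<le> 2 powr (log 2 (2 * K * 64 ^ 3 * y ^ 7) + s * x) * r3 N" .
    then have "2 powr (- (log 2 (2 * K * 64 ^ 3 * y ^ 7) + s * x)) * (2 powr (- (l' * m)) * N) \<le>
        2 powr (- (log 2 (2 * K * 64 ^ 3 * y ^ 7) + s * x)) * (2 powr (log 2 (2 * K * 64 ^ 3 * y ^ 7) + s * x) * r3 N)"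
      by (intro mult_left_mono) auto
    then have low: "2 powr (- (log 2 (2 * K * 64 ^ 3 * y ^ 7) + s * x) - l' * m) * N \<le> r3 N"
      by (simp add: mult.assoc[symmetric] powr_add[symmetric])
    \<comment> \<open>Final accounting of exponents: rounding \<open>m\<close> up costs one further
      \<open>l'\<close>, which the first asymptotic condition includes.\<close>
    have "(c + \<epsilon>) * (2 * sqrt (2 * log 2 (real N))) = 2 * s * x + 2 * sqrt 2 * \<epsilon> * x"
      unfolding x2[symmetric] c using x by (simp add: real_sqrt_mult algebra_simps)
    moreover have "l' * m \<le> l' * y" using m(2) \<open>l < l'\<close> l by (intro mult_left_mono) auto
    moreover have "l' * y = s * x + \<epsilon> * x + l'"
      unfolding y_def l'_def s(2)[symmetric] using s(1) by (simp add: field_simps)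
    moreover have "a * x = 2 * sqrt 2 * \<epsilon> * x - \<epsilon> * x" by (simp add: a_def algebra_simps)
    ultimately have "- (c + \<epsilon>) * (2 * sqrt (2 * log 2 (real N))) \<le> - (log 2 (2 * K * 64 ^ 3 * y ^ 7) + s * x) - l' * m"
      using E1 by linarith
    then have "2 powr (- (c + \<epsilon>) * (2 * sqrt (2 * log 2 (real N)))) * N \<le> 2 powr (- (log 2 (2 * K * 64 ^ 3 * y ^ 7) + s * x) - l' * m) * N"
      by (intro mult_right_mono) auto
    with low show "N * 2 powr (- (c + \<epsilon>) * (2 * sqrt (2 * log 2 (real N)))) \<le> r3 N" by (simp add: mult.commute)
  qed
qed

theorem theorem1p1:
  "\<exists>C::real. C > 0 \<and> (\<exists>f :: nat \<Rightarrow> real. f \<longlonglongrightarrow> 0 \<and>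
     (\<forall>N::nat. N \<ge> 1 \<longrightarrow>
        real (r3 N) \<ge> C * real N *
          2 powr (- (sqrt (log 2 (sqrt (32 / 9))) + f N) * 2 * sqrt (2 * log 2 (real N)))))"
proof -
  define c where "c = sqrt (log 2 (sqrt (32 / 9)))"
  define d where "d N = 2 * sqrt (2 * log 2 (real N))" for N :: nat
  \<comment> \<open>For \<open>N \<ge> 2\<close> this is the least nonnegative error for which the
    bound holds with \<open>C = 1\<close>, so the eventual estimate is needed only for
    convergence.\<close>
  define f where "f N = max 0 (- log 2 (r3 N / N) / d N - c)" for N :: nat
  have "f \<longlonglongrightarrow> 0"
  proof (rule tendstoI)
    fix e :: real assume "0 < e"
    then have "\<forall>\<^sub>F N in sequentially. N * 2 powr (- (c + e / 2) * d N) \<le> r3 N"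
      unfolding c_def d_def by (intro eventually_r3_ge) simp
    moreover have "\<forall>\<^sub>F N::nat in sequentially. 2 \<le> N" by (rule eventually_ge_at_top)
    ultimately show "\<forall>\<^sub>F N in sequentially. dist (f N) 0 < e"
    proof eventually_elim
      case (elim N)
      then have N: "0 < real N" "0 < d N" by (auto simp: d_def)
      have "2 powr (- (c + e / 2) * d N) \<le> r3 N / N" using elim(1) N(1) by (simp add: field_simps)
      then have "log 2 (2 powr (- (c + e / 2) * d N)) \<le> log 2 (r3 N / N)" by (intro log_mono) auto
      then have "- log 2 (r3 N / N) / d N \<le> c + e / 2" using N(2) by (simp add: field_simps)
      then show ?case using \<open>0 < e\<close> by (simp add: f_def)
    qed
  qed
  moreover have "1 * real N * 2 powr (- (c + f N) * 2 * sqrt (2 * log 2 (real N))) \<le> r3 N" if N: "1 \<le> N" for N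
  \<comment> \<open>At \<open>N = 1\<close> the logarithm vanishes, so \<open>d N = 0\<close> and
    the division in \<open>f\<close> carries no information; the claim reduces to
    \<open>1 \<le> r3 1\<close>.\<close>
  proof (cases "N = 1")
    case True
    then show ?thesis using r3_pos[of 1] by simp
  next
    case False
    then have pos: "0 < d N" "0 < real N" "0 < r3 N" using N r3_pos[OF N] by (auto simp: d_def)
    have "- log 2 (r3 N / N) / d N \<le> c + f N" by (simp add: f_def)
    then have "- (c + f N) * d N \<le> log 2 (r3 N / N)" using pos(1) by (simp add: field_simps)
    then have "2 powr (- (c + f N) * d N) \<le> 2 powr log 2 (r3 N / N)" by simp
    also have "\<dots> = r3 N / N" using pos by simp
    finally show ?thesis using pos(2) by (simp add: d_def field_simps)
  qed
  ultimately show ?thesis unfolding c_def[symmetric] by (intro exI[of _ 1] conjI exI[of _ f]) auto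
qed

end
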